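(* For every fixed pair of integers $r,s\ge 1$, both sequences $n\mapsto a_{r,s}(n)$ and $n\mapsto b_{r,s}(n)$ are holonomic.
   Context: Let $\mathfrak{S}_n$ be the set of permutations $\pi=\pi_1\cdots\pi_n$ of $\{1,\dots,n\}$. For integers $r,s\ge1$ set $$a_{r,s}(n)=\#\{\pi\in\mathfrak{S}_n:\ \pi_{i+r}-\pi_i\ne s\ \text{ for all } 1\le i\le n-r\},$$ $$b_{r,s}(n)=\#\{\pi\in\mathfrak{S}_n:\ |\pi_{i+r}-\pi_i|\ne s\ \text{ for all } 1\le i\le n-r\}.$$ A sequence is holonomic (P-recursive) if it satisfies a nontrivial homogeneous linear recurrence of finite order with polynomial coefficients in $n$. *)

theory Defs
  imports "HOL-Combinatorics.Permutations" "HOL-Computational_Algebra.Polynomial"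
begin

text \<open>
  A permutation of \<open>{1..n}\<close> is a function on \<open>nat\<close> that permutes \<open>{1..n}\<close> and is the identity
  elsewhere, so \<open>p i\<close> is the \<open>i\<close>-th letter of the one-line notation.
  The differences are taken in \<open>int\<close>, since subtraction on \<open>nat\<close> truncates.
\<close>

definition a_count :: "nat \<Rightarrow> nat \<Rightarrow> nat \<Rightarrow> nat" where
  "a_count r s n = card {p. p permutes {1..n} \<and>
     (\<forall>i. 1 \<le> i \<and> i + r \<le> n \<longrightarrow> int (p (i + r)) - int (p i) \<noteq> int s)}"

definition b_count :: "nat \<Rightarrow> nat \<Rightarrow> nat \<Rightarrow> nat" where
  "b_count r s n = card {p. p permutes {1..n} \<and>
     (\<forall>i. 1 \<le> i \<and> i + r \<le> n \<longrightarrow> \<bar>int (p (i + r)) - int (p i)\<bar> \<noteq> int s)}"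

text \<open>
  The recurrence is required at every \<open>n\<close>. Requiring it only for large \<open>n\<close> would give the same
  class of sequences: multiply it by a nonzero polynomial vanishing at the finitely many exceptions.
\<close>

definition holonomic :: "(nat \<Rightarrow> 'a::field_char_0) \<Rightarrow> bool" where
  "holonomic f \<longleftrightarrow> (\<exists>(d::nat) (c :: nat \<Rightarrow> 'a poly).
     (\<exists>k\<le>d. c k \<noteq> 0) \<and>
     (\<forall>n. (\<Sum>k\<le>d. poly (c k) (of_nat n) * f (n + k)) = 0))"

end

theory Submission
  imports Defs "HOL-Library.FuncSet" "HOL-Computational_Algebra.Formal_Power_Series"
begin

text \<open>
  Expand the condition by inclusion-exclusion over sets of forbidden differences that do occur.
  Such a set cuts the positions of each residue class modulo \<open>r\<close> into blocks that a permutation maps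
  rigidly into residue classes modulo \<open>s\<close> of values. Fix the numbers \<open>k\<^sub>u\<^sub>v\<close> of blocks going from
  position class \<open>u\<close> to value class \<open>v\<close> and their total lengths \<open>l\<^sub>u\<^sub>v\<close>. The blocks
  of value class \<open>v\<close> can be ordered in \<open>(\<Sum>\<^sub>u k\<^sub>u\<^sub>v)!\<close> ways, and the signed number of ways to cut position
  class \<open>u\<close> is the multinomial coefficient of the \<open>k\<^sub>u\<^sub>v\<close> times the product over \<open>v\<close> of the
  coefficient of \<open>t ^ l\<^sub>u\<^sub>v\<close> in \<open>(t (1 - e t) / (1 + t)) ^ k\<^sub>u\<^sub>v\<close>, with \<open>e = 0\<close> for signed and \<open>e = 1\<close>
  for absolute differences. So both counts are multiple sums of products of factorials, inverse factorials,
  powers and Kronecker deltas of integer affine forms in \<open>n\<close> and the summation variables.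

  Sums of this kind are holonomic by Fasenmyer's dimension count. To cope with the boundary of the
  support, call \<open>F\<close> tame if all its shifts by at most \<open>D\<close> are combinations, with polynomial coefficients
  of degree \<open>O(D)\<close>, of a number of functions that does not depend on \<open>D\<close> (the functions
  themselves may). Then the functions \<open>n\<^sup>i N\<^sup>j \<Delta>\<^sup>\<beta> F\<close> with exponents up to \<open>D\<close> are linearly dependent for
  large \<open>D\<close>. In a dependency pick \<open>\<beta>\<close> of minimal total degree, multiply by
  \<open>\<Prod>\<^sub>v binomial (- z\<^sub>v) \<beta>\<^sub>v\<close> and sum over \<open>z\<close>: summation by parts removes all other
  differences and leaves a recurrence for the sum.
\<close>

section \<open>Linear algebra and polynomial functions\<close>

text \<open>Gaussian elimination: an equation in which some unknown \<open>j0\<close> has a nonzero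
  coefficient is solved for \<open>j0\<close>, and \<open>A'\<close> is the remaining system after
  substitution. An equation with all coefficients zero is dropped.\<close>

lemma underdetermined_system:
  fixes A :: "'b \<Rightarrow> 'j \<Rightarrow> 'a::field"
  assumes "finite B" "finite J" "card B < card J"
  shows "\<exists>c. (\<exists>j\<in>J. c j \<noteq> 0) \<and> (\<forall>b\<in>B. (\<Sum>j\<in>J. c j * A b j) = 0)"
  using assms
proof (induction B arbitrary: J A rule: finite_induct)
  case empty
  then have "J \<noteq> {}" by auto
  then show ?case by (intro exI[of _ "\<lambda>_. 1"]) auto
next
  case (insert b B)
  show ?case
  proof (cases "\<forall>j\<in>J. A b j = 0")
    case True
    have "card B < card J" using insert by simp
    from insert.IH[OF \<open>finite J\<close> this, of A] True show ?thesis
      by auto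
  next
    case False
    then obtain j0 where j0: "j0 \<in> J" "A b j0 \<noteq> 0" by blast
    define J' where "J' = J - {j0}"
    define A' where "A' = (\<lambda>b' j. A b' j - A b' j0 * A b j / A b j0)"
    have fin: "finite J'" and "card B < card J'"
      using insert j0 by (auto simp: J'_def)
    from insert.IH[OF this, of A'] obtain c where c: "\<exists>j\<in>J'. c j \<noteq> 0"
      "\<And>b'. b' \<in> B \<Longrightarrow> (\<Sum>j\<in>J'. c j * A' b' j) = 0" by blast
    define s where "s = (\<Sum>j\<in>J'. c j * A b j) / A b j0"
    define c' where "c' = c(j0 := - s)"
    have split: "(\<Sum>j\<in>J. c' j * A b' j) = - s * A b' j0 + (\<Sum>j\<in>J'. c j * A b' j)" for b'
    proof -
      have "(\<Sum>j\<in>J. c' j * A b' j) = c' j0 * A b' j0 + (\<Sum>j\<in>J'. c' j * A b' j)"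
        unfolding J'_def using insert.prems(1) j0(1) by (rule sum.remove)
      also have "(\<Sum>j\<in>J'. c' j * A b' j) = (\<Sum>j\<in>J'. c j * A b' j)"
        by (rule sum.cong) (auto simp: c'_def J'_def)
      finally show ?thesis by (simp add: c'_def)
    qed
    have "(\<Sum>j\<in>J. c' j * A b' j) = 0" if "b' \<in> insert b B" for b'
    proof (cases "b' = b")
      case True
      then show ?thesis using j0 by (simp add: split s_def)
    next
      case False
      then have "0 = (\<Sum>j\<in>J'. c j * A' b' j)" using c(2) that by simp
      also have "\<dots> = (\<Sum>j\<in>J'. c j * A b' j) - (\<Sum>j\<in>J'. (c j * A b j) * (A b' j0 / A b j0))"
        by (simp add: A'_def right_diff_distrib sum_subtractf field_simps)
      also have "\<dots> = (\<Sum>j\<in>J'. c j * A b' j) - s * A b' j0"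
        by (simp add: s_def flip: sum_distrib_right sum_divide_distrib)
      finally show ?thesis by (simp add: split)
    qed
    moreover have "\<exists>j\<in>J. c' j \<noteq> 0"
      using c(1) by (auto simp: c'_def J'_def)
    ultimately show ?thesis by blast
  qed
qed

text \<open>Newton interpolation: a new node \<open>x0\<close> is accommodated by adding a multiple
  of the nodal polynomial \<open>q\<close>, which vanishes at all old nodes.\<close>

lemma poly_interpolation:
  fixes h :: "int \<Rightarrow> rat"
  assumes "finite X"
  shows "\<exists>p. degree p \<le> card X \<and> (\<forall>x\<in>X. poly p (of_int x) = h x)"
  using assms
proof (induction X rule: finite_induct)
  case empty
  show ?case by (intro exI[of _ 0]) auto
next
  case (insert x0 X)
  then obtain p where p: "degree p \<le> card X" "\<And>x. x \<in> X \<Longrightarrow> poly p (of_int x) = h x"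
    by blast
  define q :: "rat poly" where "q = (\<Prod>x\<in>X. [:- of_int x, 1:])"
  have q0: "poly q (of_int x) = (\<Prod>y\<in>X. of_int x - of_int y)" for x
    by (simp add: q_def poly_prod)
  have "degree q \<le> (\<Sum>x\<in>X. degree [:- of_int x :: rat, 1:])"
    unfolding q_def using degree_prod_sum_le[OF insert.hyps(1), of "\<lambda>x. [:- of_int x :: rat, 1:]"] by (simp add: o_def)
  then have dq: "degree q \<le> card X" by simp
  define a where "a = (h x0 - poly p (of_int x0)) / poly q (of_int x0)"
  have "poly q (of_int x0) \<noteq> 0" using insert by (auto simp: q0)
  moreover have "poly q (of_int x) = 0" if "x \<in> X" for x
    using insert that by (auto simp: q0)
  moreover have "degree (p + smult a q) \<le> card X"
    using p(1) dq by (meson degree_add_le degree_smult_le order_trans)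
  ultimately show ?case
    using p insert by (intro exI[of _ "p + smult a q"]) (auto simp: a_def)
qed

section \<open>Polynomial functions of several integer variables, filtered by total degree\<close>

inductive polyfn :: "'i set \<Rightarrow> nat \<Rightarrow> (('i \<Rightarrow> int) \<Rightarrow> rat) \<Rightarrow> bool" for I where
  const: "polyfn I d (\<lambda>_. c)"
| add: "polyfn I d p \<Longrightarrow> polyfn I d q \<Longrightarrow> polyfn I d (\<lambda>z. p z + q z)"
| var: "i \<in> I \<Longrightarrow> polyfn I d p \<Longrightarrow> polyfn I (Suc d) (\<lambda>z. of_int (z i) * p z)"

lemma polyfn_mono: "polyfn I d p \<Longrightarrow> d \<le> d' \<Longrightarrow> polyfn I d' p"
proof (induction arbitrary: d' rule: polyfn.induct)
  case (var i d p)
  then obtain d'' where "d' = Suc d''" "d \<le> d''" by (cases d') auto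
  with var show ?case by (auto intro: polyfn.var)
qed (auto intro: polyfn.intros)

lemma polyfn_smult: "polyfn I d p \<Longrightarrow> polyfn I d (\<lambda>z. c * p z)"
proof (induction rule: polyfn.induct)
  case (add d p q)
  then have "polyfn I d (\<lambda>z. c * p z + c * q z)" by (intro polyfn.add)
  then show ?case by (simp add: algebra_simps)
next
  case (var i d p)
  then have "polyfn I (Suc d) (\<lambda>z. of_int (z i) * (c * p z))" by (intro polyfn.var)
  then show ?case by (simp add: algebra_simps)
qed (rule polyfn.const)

lemma polyfn_mult: "polyfn I d p \<Longrightarrow> polyfn I d' q \<Longrightarrow> polyfn I (d + d') (\<lambda>z. p z * q z)"
proof (induction rule: polyfn.induct)
  case (const d c)
  then have "polyfn I d' (\<lambda>z. c * q z)" by (intro polyfn_smult)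
  then show ?case by (rule polyfn_mono) simp
next
  case (add d p1 p2)
  then have "polyfn I (d + d') (\<lambda>z. p1 z * q z + p2 z * q z)" by (intro polyfn.add) auto
  then show ?case by (simp add: algebra_simps)
next
  case (var i d p)
  then have "polyfn I (Suc (d + d')) (\<lambda>z. of_int (z i) * (p z * q z))" by (intro polyfn.var) auto
  then show ?case by (simp add: algebra_simps)
qed

lemma polyfn_sum:
  "(\<And>x. x \<in> X \<Longrightarrow> polyfn I d (p x)) \<Longrightarrow> polyfn I d (\<lambda>z. \<Sum>x\<in>X. p x z)"
  by (induction X rule: infinite_finite_induct) (auto intro: polyfn.const polyfn.add)

lemma polyfn_affine: "polyfn I (Suc 0) (\<lambda>z. of_int ((\<Sum>i\<in>I. a i * z i) + b))"
proof -
  have "polyfn I (Suc 0) (\<lambda>z. (\<Sum>i\<in>I. of_int (a i) * (of_int (z i) * 1)) + of_int b)"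
    by (intro polyfn.add polyfn_sum polyfn_smult polyfn.var polyfn.const)
  then show ?thesis by simp
qed

lemma polyfn_poly_affine:
  "degree p \<le> d \<Longrightarrow> polyfn I d (\<lambda>z. poly p (of_int ((\<Sum>i\<in>I. a i * z i) + b)))"
proof (induction p arbitrary: d)
  case 0
  show ?case by (simp add: polyfn.const)
next
  case (pCons a0 p)
  show ?case
  proof (cases "p = 0")
    case True
    then show ?thesis by (simp add: polyfn.const)
  next
    case False
    with pCons.prems obtain d' where d': "d = Suc d'" "degree p \<le> d'" by (cases d) auto
    from polyfn_mult[OF polyfn_affine[of I a b] pCons.IH[OF d'(2)]] show ?thesis
      unfolding d'(1) poly_pCons by (auto intro!: polyfn.add polyfn.const)
  qed
qed

lemma polyfn_power_var: "i \<in> I \<Longrightarrow> polyfn I k (\<lambda>z. of_int (z i) ^ k)"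
  by (induction k) (auto intro: polyfn.const polyfn.var)

abbreviation mono_fn :: "'i set \<Rightarrow> ('i \<Rightarrow> nat) \<Rightarrow> ('i \<Rightarrow> int) \<Rightarrow> rat" where
  "mono_fn I e z \<equiv> (\<Prod>i\<in>I. of_int (z i) ^ e i)"

text \<open>Bounding each exponent separately gives a box of \<open>(d + 1) ^ card I\<close>
  exponent vectors, which has the order of growth in \<open>d\<close> that the dimension count
  needs.\<close>

lemma polyfn_monomials:
  assumes "finite I" "polyfn I d p"
  shows "\<exists>w. \<forall>z. p z = (\<Sum>e\<in>I \<rightarrow>\<^sub>E {..d}. w e * mono_fn I e z)"
  using assms(2)
proof (induction rule: polyfn.induct)
  case (const d c)
  define e0 :: "'a \<Rightarrow> nat" where "e0 = (\<lambda>i\<in>I. 0)"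
  have e0: "e0 \<in> I \<rightarrow>\<^sub>E {..d}" by (auto simp: e0_def)
  have "mono_fn I e0 z = 1" for z by (simp add: e0_def)
  then have "(\<Sum>e\<in>I \<rightarrow>\<^sub>E {..d}. (if e = e0 then c else 0) * mono_fn I e z) = c" for z
    using e0 assms(1) by (simp add: if_distrib[of "\<lambda>x. x * _"] finite_PiE cong: if_cong)
  then show ?case by (intro exI[of _ "\<lambda>e. if e = e0 then c else 0"]) simp
next
  case (add d p q)
  then obtain w1 w2 where
    "\<And>z. p z = (\<Sum>e\<in>I \<rightarrow>\<^sub>E {..d}. w1 e * mono_fn I e z)"
    "\<And>z. q z = (\<Sum>e\<in>I \<rightarrow>\<^sub>E {..d}. w2 e * mono_fn I e z)" by blast
  then show ?case
    by (intro exI[of _ "\<lambda>e. w1 e + w2 e"]) (simp add: distrib_right sum.distrib)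
next
  case (var i d p)
  then obtain w where w: "\<And>z. p z = (\<Sum>e\<in>I \<rightarrow>\<^sub>E {..d}. w e * mono_fn I e z)" by blast
  \<comment> \<open>Multiplication by \<open>z i\<close> moves coefficients up by one in direction
    \<open>i\<close>; those without a preimage in the old box are zero.\<close>
  define w' where "w' e = (if e i = 0 \<or> e(i := e i - 1) \<notin> I \<rightarrow>\<^sub>E {..d} then 0 else w (e(i := e i - 1)))" for e
  have "of_int (z i) * p z = (\<Sum>e\<in>I \<rightarrow>\<^sub>E {..Suc d}. w' e * mono_fn I e z)" for z
  proof -
    have m: "of_int (z i) * mono_fn I e z = mono_fn I (e(i := Suc (e i))) z" for e
    proof -
      have "mono_fn I e z = of_int (z i) ^ e i * mono_fn (I - {i}) e z" for e
        by (rule prod.remove) (use assms var in auto)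
      moreover have "mono_fn (I - {i}) (e(i := Suc (e i))) z = mono_fn (I - {i}) e z"
        by (rule prod.cong) auto
      ultimately show ?thesis by simp
    qed
    have "of_int (z i) * p z = (\<Sum>e\<in>I \<rightarrow>\<^sub>E {..d}. w e * mono_fn I (e(i := Suc (e i))) z)"
      unfolding w sum_distrib_left m[symmetric] by (simp add: algebra_simps)
    also have "\<dots> = (\<Sum>e\<in>I \<rightarrow>\<^sub>E {..Suc d}. w' e * mono_fn I e z)"
    proof (rule sum.reindex_bij_witness_not_neutral[where S' = "{}"
          and T' = "{e \<in> I \<rightarrow>\<^sub>E {..Suc d}. e i = 0 \<or> e(i := e i - 1) \<notin> I \<rightarrow>\<^sub>E {..d}}"
          and i = "\<lambda>e. e(i := e i - 1)" and j = "\<lambda>e. e(i := Suc (e i))"], goal_cases)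
      case (4 a)
      then have a: "a \<in> I \<rightarrow>\<^sub>E {..d}" by simp
      then have "a(i := Suc (a i)) \<in> I \<rightarrow>\<^sub>E {..Suc d}"
        using \<open>i \<in> I\<close> by (force simp: PiE_iff extensional_def)
      with a show ?case by simp
    qed (use assms(1) in \<open>auto simp: w'_def finite_PiE\<close>)
    finally show ?thesis .
  qed
  then show ?case by blast
qed

section \<open>Tame functions\<close>

definition tame :: "'i set \<Rightarrow> (('i \<Rightarrow> int) \<Rightarrow> rat) \<Rightarrow> bool" where
  "tame I F \<longleftrightarrow> (\<exists>Q c. \<forall>D. \<exists>g :: nat \<Rightarrow> ('i \<Rightarrow> int) \<Rightarrow> rat.
     \<forall>\<alpha>. (\<forall>i\<in>I. \<bar>\<alpha> i\<bar> \<le> int D) \<longrightarrow>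
       (\<exists>p. (\<forall>q<Q. polyfn I (c * D) (p q)) \<and>
            (\<forall>z. F (\<lambda>i. z i + \<alpha> i) = (\<Sum>q<Q. g q z * p q z))))"

text \<open>One-variable form of tameness. The elementary factors depend on a single affine form, so
  for them it suffices to check this property.\<close>

definition tame1 :: "(int \<Rightarrow> rat) \<Rightarrow> bool" where
  "tame1 f \<longleftrightarrow> (\<exists>Q c. \<forall>D. \<exists>g :: nat \<Rightarrow> int \<Rightarrow> rat. \<forall>a. \<bar>a\<bar> \<le> int D \<longrightarrow>
     (\<exists>p. (\<forall>q<Q. degree (p q) \<le> c * D) \<and>
          (\<forall>x. f (x + a) = (\<Sum>q<Q. g q x * poly (p q) (of_int x)))))"

text \<open>An arbitrary finite index set may replace \<open>{..<Q}\<close>; disjoint unions and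
  products of index sets then serve for sums and products of functions.\<close>

lemma tameI:
  fixes K :: "'k set"
  assumes "finite K"
    and "\<And>D. \<exists>g :: 'k \<Rightarrow> ('i \<Rightarrow> int) \<Rightarrow> rat. \<forall>\<alpha>. (\<forall>i\<in>I. \<bar>\<alpha> i\<bar> \<le> int D) \<longrightarrow>
       (\<exists>p. (\<forall>q\<in>K. polyfn I (c * D) (p q)) \<and> (\<forall>z. F (\<lambda>i. z i + \<alpha> i) = (\<Sum>q\<in>K. g q z * p q z)))"
  shows "tame I F"
proof -
  from ex_bij_betw_nat_finite[OF assms(1)]
  obtain h where h: "bij_betw h {..<card K} K" by (auto simp: atLeast0LessThan)
  show ?thesis
    unfolding tame_def
  proof (rule exI[of _ "card K"], rule exI[of _ c], rule allI)
    fix D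
    from assms(2)[of D] obtain g where g: "\<And>\<alpha>. (\<forall>i\<in>I. \<bar>\<alpha> i\<bar> \<le> int D) \<Longrightarrow>
       (\<exists>p. (\<forall>q\<in>K. polyfn I (c * D) (p q)) \<and> (\<forall>z. F (\<lambda>i. z i + \<alpha> i) = (\<Sum>q\<in>K. g q z * p q z)))"
      by blast
    show "\<exists>g. \<forall>\<alpha>. (\<forall>i\<in>I. \<bar>\<alpha> i\<bar> \<le> int D) \<longrightarrow> (\<exists>p. (\<forall>q<card K. polyfn I (c * D) (p q)) \<and>
      (\<forall>z. F (\<lambda>i. z i + \<alpha> i) = (\<Sum>q<card K. g q z * p q z)))"
    proof (rule exI[of _ "\<lambda>q. g (h q)"], intro allI impI)
      fix \<alpha> :: "'i \<Rightarrow> int"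
      assume "\<forall>i\<in>I. \<bar>\<alpha> i\<bar> \<le> int D"
      from g[OF this] obtain p where p: "\<And>q. q \<in> K \<Longrightarrow> polyfn I (c * D) (p q)"
        "\<And>z. F (\<lambda>i. z i + \<alpha> i) = (\<Sum>q\<in>K. g q z * p q z)" by blast
      have "\<forall>q<card K. polyfn I (c * D) (p (h q))"
        using p(1) h by (auto simp: bij_betw_def)
      moreover have "(\<Sum>q\<in>K. g q z * p q z) = (\<Sum>q<card K. g (h q) z * p (h q) z)" for z
        by (rule sum.reindex_bij_betw[OF h, symmetric])
      ultimately show "\<exists>p. (\<forall>q<card K. polyfn I (c * D) (p q)) \<and>
          (\<forall>z. F (\<lambda>i. z i + \<alpha> i) = (\<Sum>q<card K. g (h q) z * p q z))"
        using p(2) by (intro exI[of _ "\<lambda>q. p (h q)"]) simp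
    qed
  qed
qed

lemma tame_const: "tame I (\<lambda>_. a)"
proof (rule tameI[of "{()}" I 0], goal_cases)
  case (2 D)
  show ?case
    by (rule exI[of _ "\<lambda>_ _. a"]) (auto intro!: exI[of _ "\<lambda>_ _. 1"] polyfn.const)
qed simp

lemma tame_add:
  assumes "tame I F" "tame I G"
  shows "tame I (\<lambda>z. F z + G z)"
proof -
  from assms(1) obtain Q1 c1 where 1: "\<And>D. \<exists>g :: nat \<Rightarrow> ('a \<Rightarrow> int) \<Rightarrow> rat.
     \<forall>\<alpha>. (\<forall>i\<in>I. \<bar>\<alpha> i\<bar> \<le> int D) \<longrightarrow> (\<exists>p. (\<forall>q<Q1. polyfn I (c1 * D) (p q)) \<and>
       (\<forall>z. F (\<lambda>i. z i + \<alpha> i) = (\<Sum>q<Q1. g q z * p q z)))" unfolding tame_def by blast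
  from assms(2) obtain Q2 c2 where 2: "\<And>D. \<exists>g :: nat \<Rightarrow> ('a \<Rightarrow> int) \<Rightarrow> rat.
     \<forall>\<alpha>. (\<forall>i\<in>I. \<bar>\<alpha> i\<bar> \<le> int D) \<longrightarrow> (\<exists>p. (\<forall>q<Q2. polyfn I (c2 * D) (p q)) \<and>
       (\<forall>z. G (\<lambda>i. z i + \<alpha> i) = (\<Sum>q<Q2. g q z * p q z)))" unfolding tame_def by blast
  show ?thesis
  proof (rule tameI[of "{..<Q1} <+> {..<Q2}" I "c1 + c2"])
    fix D
    from 1[of D] obtain g1 where g1: "\<And>\<alpha>. (\<forall>i\<in>I. \<bar>\<alpha> i\<bar> \<le> int D) \<Longrightarrow>
      (\<exists>p. (\<forall>q<Q1. polyfn I (c1 * D) (p q)) \<and>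
       (\<forall>z. F (\<lambda>i. z i + \<alpha> i) = (\<Sum>q<Q1. g1 q z * p q z)))" by blast
    from 2[of D] obtain g2 where g2: "\<And>\<alpha>. (\<forall>i\<in>I. \<bar>\<alpha> i\<bar> \<le> int D) \<Longrightarrow>
      (\<exists>p. (\<forall>q<Q2. polyfn I (c2 * D) (p q)) \<and>
       (\<forall>z. G (\<lambda>i. z i + \<alpha> i) = (\<Sum>q<Q2. g2 q z * p q z)))" by blast
    show "\<exists>g. \<forall>\<alpha>. (\<forall>i\<in>I. \<bar>\<alpha> i\<bar> \<le> int D) \<longrightarrow>
       (\<exists>p. (\<forall>q\<in>{..<Q1} <+> {..<Q2}. polyfn I ((c1 + c2) * D) (p q)) \<and>
        (\<forall>z. F (\<lambda>i. z i + \<alpha> i) + G (\<lambda>i. z i + \<alpha> i) = (\<Sum>q\<in>{..<Q1} <+> {..<Q2}. g q z * p q z)))"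
    proof (rule exI[of _ "case_sum g1 g2"], intro allI impI)
      fix \<alpha> :: "'a \<Rightarrow> int"
      assume \<alpha>: "\<forall>i\<in>I. \<bar>\<alpha> i\<bar> \<le> int D"
      from g1[OF \<alpha>] obtain p1 where p1: "\<And>q. q < Q1 \<Longrightarrow> polyfn I (c1 * D) (p1 q)"
        "\<And>z. F (\<lambda>i. z i + \<alpha> i) = (\<Sum>q<Q1. g1 q z * p1 q z)" by blast
      from g2[OF \<alpha>] obtain p2 where p2: "\<And>q. q < Q2 \<Longrightarrow> polyfn I (c2 * D) (p2 q)"
        "\<And>z. G (\<lambda>i. z i + \<alpha> i) = (\<Sum>q<Q2. g2 q z * p2 q z)" by blast
      show "\<exists>p. (\<forall>q\<in>{..<Q1} <+> {..<Q2}. polyfn I ((c1 + c2) * D) (p q)) \<and>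
        (\<forall>z. F (\<lambda>i. z i + \<alpha> i) + G (\<lambda>i. z i + \<alpha> i) =
          (\<Sum>q\<in>{..<Q1} <+> {..<Q2}. case_sum g1 g2 q z * p q z))"
        using p1(1) p2(1)
        by (intro exI[of _ "case_sum p1 p2"])
          (auto simp: p1(2) p2(2) sum.Plus distrib_right intro: polyfn_mono[OF _ le_add1] polyfn_mono[OF _ le_add2])
    qed
  qed simp
qed

text \<open>The products of one function from each family express all shifts of the product. Their
  number is still independent of \<open>D\<close>, and the degrees of the coefficients add.\<close>

lemma tame_mult:
  assumes "tame I F" "tame I G"
  shows "tame I (\<lambda>z. F z * G z)"
proof -
  from assms(1) obtain Q1 c1 where 1: "\<And>D. \<exists>g :: nat \<Rightarrow> ('a \<Rightarrow> int) \<Rightarrow> rat.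
     \<forall>\<alpha>. (\<forall>i\<in>I. \<bar>\<alpha> i\<bar> \<le> int D) \<longrightarrow> (\<exists>p. (\<forall>q<Q1. polyfn I (c1 * D) (p q)) \<and>
       (\<forall>z. F (\<lambda>i. z i + \<alpha> i) = (\<Sum>q<Q1. g q z * p q z)))" unfolding tame_def by blast
  from assms(2) obtain Q2 c2 where 2: "\<And>D. \<exists>g :: nat \<Rightarrow> ('a \<Rightarrow> int) \<Rightarrow> rat.
     \<forall>\<alpha>. (\<forall>i\<in>I. \<bar>\<alpha> i\<bar> \<le> int D) \<longrightarrow> (\<exists>p. (\<forall>q<Q2. polyfn I (c2 * D) (p q)) \<and>
       (\<forall>z. G (\<lambda>i. z i + \<alpha> i) = (\<Sum>q<Q2. g q z * p q z)))" unfolding tame_def by blast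
  show ?thesis
  proof (rule tameI[of "{..<Q1} \<times> {..<Q2}" I "c1 + c2"])
    fix D
    from 1[of D] obtain g1 where g1: "\<And>\<alpha>. (\<forall>i\<in>I. \<bar>\<alpha> i\<bar> \<le> int D) \<Longrightarrow>
      (\<exists>p. (\<forall>q<Q1. polyfn I (c1 * D) (p q)) \<and>
       (\<forall>z. F (\<lambda>i. z i + \<alpha> i) = (\<Sum>q<Q1. g1 q z * p q z)))" by blast
    from 2[of D] obtain g2 where g2: "\<And>\<alpha>. (\<forall>i\<in>I. \<bar>\<alpha> i\<bar> \<le> int D) \<Longrightarrow>
      (\<exists>p. (\<forall>q<Q2. polyfn I (c2 * D) (p q)) \<and>
       (\<forall>z. G (\<lambda>i. z i + \<alpha> i) = (\<Sum>q<Q2. g2 q z * p q z)))" by blast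
    show "\<exists>g. \<forall>\<alpha>. (\<forall>i\<in>I. \<bar>\<alpha> i\<bar> \<le> int D) \<longrightarrow>
       (\<exists>p. (\<forall>q\<in>{..<Q1} \<times> {..<Q2}. polyfn I ((c1 + c2) * D) (p q)) \<and>
        (\<forall>z. F (\<lambda>i. z i + \<alpha> i) * G (\<lambda>i. z i + \<alpha> i) = (\<Sum>q\<in>{..<Q1} \<times> {..<Q2}. g q z * p q z)))"
    proof (rule exI[of _ "\<lambda>q z. g1 (fst q) z * g2 (snd q) z"], intro allI impI)
      fix \<alpha> :: "'a \<Rightarrow> int"
      assume \<alpha>: "\<forall>i\<in>I. \<bar>\<alpha> i\<bar> \<le> int D"
      from g1[OF \<alpha>] obtain p1 where p1: "\<And>q. q < Q1 \<Longrightarrow> polyfn I (c1 * D) (p1 q)"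
        "\<And>z. F (\<lambda>i. z i + \<alpha> i) = (\<Sum>q<Q1. g1 q z * p1 q z)" by blast
      from g2[OF \<alpha>] obtain p2 where p2: "\<And>q. q < Q2 \<Longrightarrow> polyfn I (c2 * D) (p2 q)"
        "\<And>z. G (\<lambda>i. z i + \<alpha> i) = (\<Sum>q<Q2. g2 q z * p2 q z)" by blast
      have "F (\<lambda>i. z i + \<alpha> i) * G (\<lambda>i. z i + \<alpha> i) = (\<Sum>q\<in>{..<Q1} \<times> {..<Q2}.
          g1 (fst q) z * g2 (snd q) z * (p1 (fst q) z * p2 (snd q) z))" for z
        unfolding p1(2) p2(2) sum_product sum.cartesian_product
        by (rule sum.cong) (auto simp: algebra_simps)
      moreover have "polyfn I ((c1 + c2) * D) (\<lambda>z. p1 (fst q) z * p2 (snd q) z)"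
        if "q \<in> {..<Q1} \<times> {..<Q2}" for q
        unfolding distrib_right using that p1(1) p2(1) by (intro polyfn_mult) auto
      ultimately show "\<exists>p. (\<forall>q\<in>{..<Q1} \<times> {..<Q2}. polyfn I ((c1 + c2) * D) (p q)) \<and>
        (\<forall>z. F (\<lambda>i. z i + \<alpha> i) * G (\<lambda>i. z i + \<alpha> i) =
          (\<Sum>q\<in>{..<Q1} \<times> {..<Q2}. g1 (fst q) z * g2 (snd q) z * p q z))"
        by (intro exI[of _ "\<lambda>q z. p1 (fst q) z * p2 (snd q) z"]) blast
    qed
  qed simp
qed

lemma tame_sum: "(\<And>x. x \<in> X \<Longrightarrow> tame I (F x)) \<Longrightarrow> tame I (\<lambda>z. \<Sum>x\<in>X. F x z)"
  by (induction X rule: infinite_finite_induct) (auto intro: tame_const tame_add)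

lemma tame_prod: "(\<And>x. x \<in> X \<Longrightarrow> tame I (F x)) \<Longrightarrow> tame I (\<lambda>z. \<Prod>x\<in>X. F x z)"
  by (induction X rule: infinite_finite_induct) (auto intro: tame_const tame_mult)

text \<open>A shift of \<open>z\<close> by at most \<open>D\<close> in each coordinate shifts the
  affine form by at most \<open>S * D\<close>, where \<open>S\<close> is the sum of the absolute
  values of its coefficients. One-variable tameness at \<open>S * D\<close> costs only a factor
  \<open>S\<close> in the degree bound.\<close>

lemma tame_affine:
  assumes "tame1 f" "finite I"
  shows "tame I (\<lambda>z. f ((\<Sum>i\<in>I. a i * z i) + b))"
proof -
  from assms(1) obtain Q c where Q: "\<And>D. \<exists>g :: nat \<Rightarrow> int \<Rightarrow> rat. \<forall>a. \<bar>a\<bar> \<le> int D \<longrightarrow>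
     (\<exists>p. (\<forall>q<Q. degree (p q) \<le> c * D) \<and>
          (\<forall>x. f (x + a) = (\<Sum>q<Q. g q x * poly (p q) (of_int x))))"
    unfolding tame1_def by blast
  define S where "S = nat (\<Sum>i\<in>I. \<bar>a i\<bar>)"
  let ?L = "\<lambda>z. (\<Sum>i\<in>I. a i * z i) + b"
  show ?thesis
  proof (rule tameI[of "{..<Q}" I "c * S"])
    fix D
    from Q[of "S * D"] obtain g where g: "\<And>a. \<bar>a\<bar> \<le> int (S * D) \<Longrightarrow>
     (\<exists>p. (\<forall>q<Q. degree (p q) \<le> c * (S * D)) \<and>
          (\<forall>x. f (x + a) = (\<Sum>q<Q. g q x * poly (p q) (of_int x))))" by blast
    show "\<exists>g. \<forall>\<alpha>. (\<forall>i\<in>I. \<bar>\<alpha> i\<bar> \<le> int D) \<longrightarrow>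
       (\<exists>p. (\<forall>q\<in>{..<Q}. polyfn I (c * S * D) (p q)) \<and>
          (\<forall>z. f (?L (\<lambda>i. z i + \<alpha> i)) = (\<Sum>q<Q. g q z * p q z)))"
    proof (rule exI[of _ "\<lambda>q z. g q (?L z)"], intro allI impI)
      fix \<alpha> :: "'a \<Rightarrow> int"
      assume \<alpha>: "\<forall>i\<in>I. \<bar>\<alpha> i\<bar> \<le> int D"
      define t where "t = (\<Sum>i\<in>I. a i * \<alpha> i)"
      have "\<bar>t\<bar> \<le> (\<Sum>i\<in>I. \<bar>a i\<bar> * int D)"
        unfolding t_def using \<alpha>
        by (intro order.trans[OF sum_abs] sum_mono) (auto simp: abs_mult intro: mult_left_mono)
      also have "\<dots> = int (S * D)"
        by (simp add: S_def sum_nonneg flip: sum_distrib_right)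
      finally obtain p where p: "\<And>q. q < Q \<Longrightarrow> degree (p q) \<le> c * (S * D)"
        "\<And>x. f (x + t) = (\<Sum>q<Q. g q x * poly (p q) (of_int x))" using g by blast
      have "?L (\<lambda>i. z i + \<alpha> i) = ?L z + t" for z
        by (simp add: t_def algebra_simps sum.distrib)
      then show "\<exists>p. (\<forall>q\<in>{..<Q}. polyfn I (c * S * D) (p q)) \<and>
          (\<forall>z. f (?L (\<lambda>i. z i + \<alpha> i)) = (\<Sum>q<Q. g q (?L z) * p q z))"
        using p(1) by (intro exI[of _ "\<lambda>q z. poly (p q) (of_int (?L z))"])
          (auto simp only: p(2) mult.assoc lessThan_iff intro!: polyfn_poly_affine)
    qed
  qed simp
qed

text \<open>Away from a window of width \<open>O(D)\<close> around the origin one polynomial per shift has to be supplied;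
  inside the window, interpolation does the job.\<close>

lemma tame1I:
  assumes neg: "\<And>x. x < 0 \<Longrightarrow> f x = 0"
    and pos: "\<And>D. \<exists>g. \<forall>a. \<bar>a\<bar> \<le> int D \<longrightarrow>
       (\<exists>p. degree p \<le> c * D \<and> (\<forall>x>int D. f (x + a) = g x * poly p (of_int x)))"
  shows "tame1 f"
  unfolding tame1_def
proof (rule exI[of _ 2], rule exI[of _ "c + 3"], rule allI)
  fix D
  from pos[of D] obtain g where g: "\<And>a. \<bar>a\<bar> \<le> int D \<Longrightarrow>
       (\<exists>p. degree p \<le> c * D \<and> (\<forall>x>int D. f (x + a) = g x * poly p (of_int x)))" by blast
  let ?g = "\<lambda>q x. if q = (0::nat) then (if x > int D then g x else 0)
              else (if x \<in> {- int D..int D} then (if D = 0 then f x else 1) else 0)"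
  show "\<exists>g. \<forall>a. \<bar>a\<bar> \<le> int D \<longrightarrow> (\<exists>p. (\<forall>q<2::nat. degree (p q) \<le> (c + 3) * D) \<and>
          (\<forall>x. f (x + a) = (\<Sum>q<2. g q x * poly (p q) (of_int x))))"
  proof (rule exI[of _ ?g], intro allI impI)
    fix a :: int assume a: "\<bar>a\<bar> \<le> int D"
    from g[OF a] obtain p where p: "degree p \<le> c * D"
      "\<And>x. x > int D \<Longrightarrow> f (x + a) = g x * poly p (of_int x)" by blast
    from poly_interpolation[of "{- int D..int D}" "\<lambda>x. f (x + a)"]
    obtain w where w: "degree w \<le> card {- int D..int D}"
      "\<And>x. x \<in> {- int D..int D} \<Longrightarrow> poly w (of_int x) = f (x + a)" by blast
    have [simp]: "{..<2::nat} = {0, 1}" by auto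
    let ?p = "\<lambda>q. if q = (0::nat) then p else if D = 0 then 1 else w"
    have dw: "degree w \<le> (c + 3) * D" if "D > 0"
    proof -
      have "degree w \<le> 2 * D + 1" using w(1) by simp
      also have "\<dots> \<le> 3 * D" using that by simp
      finally show ?thesis by (simp add: algebra_simps)
    qed
    show "\<exists>p. (\<forall>q<2. degree (p q) \<le> (c + 3) * D) \<and>
          (\<forall>x. f (x + a) = (\<Sum>q<2. ?g q x * poly (p q) (of_int x)))"
    proof (intro exI[of _ ?p] conjI allI impI)
      fix q :: nat
      show "degree (?p q) \<le> (c + 3) * D" using p(1) dw by (auto simp: algebra_simps)
    next
      fix x :: int
      consider "x > int D" | "x \<in> {- int D..int D}" "D > 0" | "x = 0" "D = 0" | "x < - int D"
        by fastforce
      then show "f (x + a) = (\<Sum>q<2. ?g q x * poly (?p q) (of_int x))"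
      proof cases
        case 4
        then have "x + a < 0" using a by linarith
        then show ?thesis using 4 neg by auto
      qed (use a p(2) w(2) in auto)
    qed
  qed
qed

section \<open>Tameness of factorials, inverse factorials, powers and deltas, extended by zero to
  negative arguments\<close>

definition zfact :: "int \<Rightarrow> rat" where "zfact x = (if x < 0 then 0 else fact (nat x))"
definition zinvfact :: "int \<Rightarrow> rat" where "zinvfact x = (if x < 0 then 0 else inverse (fact (nat x)))"
definition zpow :: "rat \<Rightarrow> int \<Rightarrow> rat" where "zpow t x = (if x < 0 then 0 else t ^ nat x)"
definition zdelta :: "int \<Rightarrow> rat" where "zdelta x = (if x = 0 then 1 else 0)"

text \<open>The quotient of the two factorials is a product of \<open>m\<close> consecutive linear
  factors in \<open>y\<close>.\<close>

lemma fact_shift_poly: "\<exists>p. degree p \<le> m \<and> (\<forall>y. y \<ge> b \<longrightarrow>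
    fact (nat (y - b) + m) = fact (nat (y - b)) * poly p (of_int y :: rat))"
proof (induction m)
  case 0
  show ?case by (intro exI[of _ 1]) auto
next
  case (Suc m)
  then obtain p where p: "degree p \<le> m" "\<And>y. y \<ge> b \<Longrightarrow>
    fact (nat (y - b) + m) = fact (nat (y - b)) * poly p (of_int y :: rat)" by blast
  have "degree ([:of_int (int m + 1 - b), 1:] * p) \<le> Suc m"
    using degree_mult_le[of "[:of_int (int m + 1 - b), 1:]" p] p(1) by (simp split: if_splits)
  moreover have "fact (nat (y - b) + Suc m) = 
      fact (nat (y - b)) * poly ([:of_int (int m + 1 - b), 1:] * p) (of_int y :: rat)" if "y \<ge> b" for y
  proof -
    have "of_nat (nat (y - b)) = (of_int y - of_int b :: rat)" using that
      by (simp add: of_nat_nat)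
    then show ?thesis using p(2)[OF that] by (simp add: algebra_simps)
  qed
  ultimately show ?case by blast
qed

lemma tame1_zfact: "tame1 zfact"
proof (rule tame1I[where c = 2])
  fix D
  show "\<exists>g. \<forall>a. \<bar>a\<bar> \<le> int D \<longrightarrow>
       (\<exists>p. degree p \<le> 2 * D \<and> (\<forall>x>int D. zfact (x + a) = g x * poly p (of_int x)))"
  \<comment> \<open>The lowest shift is the reference: every other shifted factorial is a polynomial
    multiple of it.\<close>
  proof (rule exI[of _ "\<lambda>x. fact (nat (x - int D))"], intro allI impI)
    fix a assume a: "\<bar>a\<bar> \<le> int D"
    from fact_shift_poly[of "nat (a + int D)" "int D"] obtain p where
      p: "degree p \<le> nat (a + int D)" "\<And>y. y \<ge> int D \<Longrightarrow> fact (nat (y - int D) + nat (a + int D)) =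
           fact (nat (y - int D)) * poly p (of_int y :: rat)" by blast
    have "nat (x - int D) + nat (a + int D) = nat (x + a)" if "x > int D" for x
      using that a by linarith
    then have "zfact (x + a) = fact (nat (x - int D)) * poly p (of_int x)" if "x > int D" for x
      using p(2)[of x] a that by (simp add: zfact_def)
    then show "\<exists>p. degree p \<le> 2 * D \<and> (\<forall>x>int D. zfact (x + a) = fact (nat (x - int D)) * poly p (of_int x))"
      using p(1) a by (intro exI[of _ p]) auto
  qed
qed (simp add: zfact_def)

lemma tame1_zinvfact: "tame1 zinvfact"
proof (rule tame1I[where c = 2])
  fix D
  show "\<exists>g. \<forall>a. \<bar>a\<bar> \<le> int D \<longrightarrow>
       (\<exists>p. degree p \<le> 2 * D \<and> (\<forall>x>int D. zinvfact (x + a) = g x * poly p (of_int x)))"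
  \<comment> \<open>For reciprocals the highest shift is the reference: \<open>1 / (x + a)!\<close>
    is a polynomial multiple of \<open>1 / (x + D)!\<close>.\<close>
  proof (rule exI[of _ "\<lambda>x. inverse (fact (nat (x + int D)))"], intro allI impI)
    fix a assume a: "\<bar>a\<bar> \<le> int D"
    from fact_shift_poly[of "nat (int D - a)" "- a"] obtain p where
      p: "degree p \<le> nat (int D - a)" "\<And>y. y \<ge> - a \<Longrightarrow> fact (nat (y + a) + nat (int D - a)) =
           fact (nat (y + a)) * poly p (of_int y :: rat)" by auto
    have "zinvfact (x + a) = inverse (fact (nat (x + int D))) * poly p (of_int x)" if "x > int D" for x
    proof -
      have "nat (x + a) + nat (int D - a) = nat (x + int D)" using that a by linarith
      then have "fact (nat (x + int D)) = fact (nat (x + a)) * poly p (of_int x)"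
        using p(2)[of x] a that by fastforce
      moreover have "zinvfact (x + a) = inverse (fact (nat (x + a)))"
        using that a by (simp add: zinvfact_def)
      moreover from calculation(1) have "poly p (of_int x) \<noteq> 0"
        by (metis fact_nonzero mult_zero_right)
      ultimately show ?thesis by simp
    qed
    then show "\<exists>p. degree p \<le> 2 * D \<and>
        (\<forall>x>int D. zinvfact (x + a) = inverse (fact (nat (x + int D))) * poly p (of_int x))"
      using p(1) a by (intro exI[of _ p]) auto
  qed
qed (simp add: zinvfact_def)

lemma tame1_zpow: "tame1 (zpow t)"
proof (rule tame1I[where c = 0])
  fix D
  show "\<exists>g. \<forall>a. \<bar>a\<bar> \<le> int D \<longrightarrow>
       (\<exists>p. degree p \<le> 0 * D \<and> (\<forall>x>int D. zpow t (x + a) = g x * poly p (of_int x)))"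
  \<comment> \<open>Taking the lowest exponent as reference avoids dividing by \<open>t\<close>,
    which may be zero.\<close>
  proof (rule exI[of _ "\<lambda>x. t ^ nat (x - int D)"], intro allI impI)
    fix a assume a: "\<bar>a\<bar> \<le> int D"
    have "zpow t (x + a) = t ^ nat (x - int D) * poly [:t ^ nat (a + int D):] (of_int x)"
      if "x > int D" for x
    proof -
      have "nat (x + a) = nat (x - int D) + nat (a + int D)" using that a by linarith
      then show ?thesis using that a by (simp add: zpow_def power_add)
    qed
    then show "\<exists>p. degree p \<le> 0 * D \<and>
        (\<forall>x>int D. zpow t (x + a) = t ^ nat (x - int D) * poly p (of_int x))"
      by (intro exI[of _ "[:t ^ nat (a + int D):]"]) auto
  qed
qed (simp add: zpow_def)

lemma tame1_zdelta: "tame1 zdelta"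
proof (rule tame1I[where c = 0])
  fix D
  show "\<exists>g. \<forall>a. \<bar>a\<bar> \<le> int D \<longrightarrow>
       (\<exists>p. degree p \<le> 0 * D \<and> (\<forall>x>int D. zdelta (x + a) = g x * poly p (of_int x)))"
    by (intro exI[of _ "\<lambda>_. 0"]) (auto simp: zdelta_def intro!: exI[of _ 0])
qed (simp add: zdelta_def)

section \<open>Sums of tame functions are holonomic\<close>

text \<open>The left side is the \<open>b\<close>-th forward difference of
  \<open>x gchoose e\<close>. By Pascal's rule each difference lowers \<open>e\<close> by one, and
  once the function is constant the next difference is zero.\<close>

lemma gchoose_difference:
  fixes x :: rat
  shows "(\<Sum>a\<le>b. (- 1) ^ (b - a) * of_nat (b choose a) * ((x + of_nat a) gchoose e)) =
    (if b \<le> e then x gchoose (e - b) else 0)"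
proof (induction b arbitrary: x)
  case 0
  show ?case by simp
next
  case (Suc b)
  let ?t = "\<lambda>b x a. (- 1) ^ (b - a) * of_nat (b choose a) * ((x + of_nat a) gchoose e)"
  have "(\<Sum>a\<le>Suc b. ?t (Suc b) x a) =
      ?t (Suc b) x 0 + (\<Sum>a\<le>b. ?t (Suc b) x (Suc a))"
    by (rule sum.atMost_Suc_shift)
  also have "(\<Sum>a\<le>b. ?t (Suc b) x (Suc a)) =
      (\<Sum>a\<le>b. ?t b (x + 1) a) + (\<Sum>a\<le>b. (- 1) ^ (b - a) * of_nat (b choose Suc a) * ((x + 1 + of_nat a) gchoose e))"
    by (simp add: algebra_simps flip: sum.distrib)
  also have "(\<Sum>a\<le>b. (- 1) ^ (b - a) * of_nat (b choose Suc a) * ((x + 1 + of_nat a) gchoose e)) =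
      - (\<Sum>a\<in>{1..Suc b}. ?t b x a)"
  proof -
    have "(\<Sum>a\<in>{1..Suc b}. ?t b x a) = (\<Sum>a\<le>b. ?t b x (Suc a))"
      by (simp only: One_nat_def sum.shift_bounds_cl_Suc_ivl atMost_atLeast0)
    also have "\<dots> = - (\<Sum>a\<le>b. (- 1) ^ (b - a) * of_nat (b choose Suc a) * ((x + 1 + of_nat a) gchoose e))"
    proof (subst sum_negf[symmetric], rule sum.cong)
      fix a assume "a \<in> {..b}"
      show "?t b x (Suc a) = - ((- 1) ^ (b - a) * of_nat (b choose Suc a) * ((x + 1 + of_nat a) gchoose e))"
      proof (cases "a = b")
        case False
        with \<open>a \<in> {..b}\<close> have "b - a = Suc (b - Suc a)" by auto
        then show ?thesis by (simp add: algebra_simps)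
      qed (simp add: binomial_eq_0)
    qed simp
    finally show ?thesis by simp
  qed
  also have "(\<Sum>a\<in>{1..Suc b}. ?t b x a) = (\<Sum>a\<in>{1..b}. ?t b x a)"
    by simp
  also have "?t (Suc b) x 0 + ((\<Sum>a\<le>b. ?t b (x + 1) a) + - (\<Sum>a\<in>{1..b}. ?t b x a)) =
      (\<Sum>a\<le>b. ?t b (x + 1) a) - (\<Sum>a\<le>b. ?t b x a)"
    by (simp add: atMost_atLeast0 sum.atLeast_Suc_atMost)
  also have "\<dots> = (if Suc b \<le> e then x gchoose (e - Suc b) else 0)"
  proof (cases "Suc b \<le> e")
    case True
    then have "e - b = Suc (e - Suc b)" by simp
    then show ?thesis using True by (simp add: Suc.IH gbinomial_Suc_Suc)
  next
    case False
    then show ?thesis by (auto simp: Suc.IH)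
  qed
  finally show ?case .
qed

text \<open>Summation by parts in raw form: translating the summation variable moves the shift from
  \<open>f\<close> to the weight \<open>w\<close>. The large box leaves enough room that the
  translated support stays inside it.\<close>

lemma sum_PiE_shift:
  fixes f w :: "('i \<Rightarrow> int) \<Rightarrow> 'a::comm_semiring_0"
  assumes "finite I" and a: "\<And>i. i \<in> I \<Longrightarrow> 0 \<le> a i \<and> a i \<le> R - m" and m: "0 \<le> m" "m \<le> R"
    and supp: "\<And>z. z \<in> extensional I \<Longrightarrow> z \<notin> I \<rightarrow>\<^sub>E {0..m} \<Longrightarrow> f z = 0"
  shows "(\<Sum>z\<in>I \<rightarrow>\<^sub>E {-R..R}. w z * f (\<lambda>i. if i \<in> I then z i + a i else z i)) =
    (\<Sum>z\<in>I \<rightarrow>\<^sub>E {0..m}. w (\<lambda>i. if i \<in> I then z i - a i else z i) * f z)"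
proof -
  let ?up = "\<lambda>z i. if i \<in> I then z i + a i else z i"
  let ?dn = "\<lambda>z i. if i \<in> I then z i - a i else z i"
  have up: "?up (?dn z) = z" and dn: "?dn (?up z) = z" for z by auto
  show ?thesis
  proof (rule sum.reindex_bij_witness_not_neutral[where i = ?dn and j = ?up and T' = "{}"
        and S' = "{z \<in> I \<rightarrow>\<^sub>E {-R..R}. ?up z \<notin> I \<rightarrow>\<^sub>E {0..m}}"], goal_cases)
    case (6 z)
    then have "?dn z \<in> I \<rightarrow>\<^sub>E {-R..R}"
      using a m by (force simp: PiE_iff extensional_def)
    moreover have "?up (?dn z) \<in> I \<rightarrow>\<^sub>E {0..m}" unfolding up using 6 by simp
    ultimately show ?case by simp
  next
    case (7 z)
    then have "?up z \<in> extensional I" by (auto simp: PiE_iff extensional_def)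
    with 7 supp[of "?up z"] show ?case by simp
  qed (use assms(1) in \<open>auto simp: up dn finite_PiE\<close>)
qed

text \<open>The coordinate \<open>i0\<close> carries \<open>n\<close> and is shifted by
  \<open>N\<close> to the power \<open>j\<close>; the remaining coordinates of \<open>I\<close> are
  summation variables.\<close>

abbreviation fwd_shift :: "'i set \<Rightarrow> 'i \<Rightarrow> nat \<Rightarrow> ('i \<Rightarrow> nat) \<Rightarrow> 'i \<Rightarrow> int" where
  "fwd_shift I i0 j \<alpha> \<equiv> (\<lambda>i. if i = i0 then int j else if i \<in> I then int (\<alpha> i) else 0)"

text \<open>Coefficients in the expansion of the mixed forward difference of order
  \<open>\<beta>\<close> into shifts.\<close>

abbreviation diff_coeff :: "'i set \<Rightarrow> ('i \<Rightarrow> nat) \<Rightarrow> ('i \<Rightarrow> nat) \<Rightarrow> rat" where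
  "diff_coeff I \<beta> \<alpha> \<equiv> (\<Prod>v\<in>I. (- 1) ^ (\<beta> v - \<alpha> v) * of_nat (\<beta> v choose \<alpha> v))"

text \<open>Dimension count: the functions \<open>n\<^sup>i N\<^sup>j \<Delta>\<^sup>\<beta> F\<close> with all exponents at most \<open>D\<close> number
  \<open>(D + 1) ^ (card I + 1)\<close>, but they lie in a space of dimension \<open>O(D ^ card I)\<close>.\<close>

lemma tame_relation:
  assumes "tame I F" "finite I" "i0 \<in> I"
  defines "I' \<equiv> I - {i0}"
  obtains D p where
    "\<exists>t \<in> {..D} \<times> {..D} \<times> (I' \<rightarrow>\<^sub>E {..D}). p t \<noteq> 0"
    "\<And>z. (\<Sum>(i, j, \<beta>) \<in> {..D} \<times> {..D} \<times> (I' \<rightarrow>\<^sub>E {..D}). p (i, j, \<beta>) * (of_int (z i0) ^ i *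
       (\<Sum>\<alpha>\<in>PiE I' (\<lambda>v. {..\<beta> v}). diff_coeff I' \<beta> \<alpha> * F (\<lambda>i. z i + fwd_shift I i0 j \<alpha> i)))) = 0"
proof -
  from assms(1) obtain Q c where tm: "\<And>D. \<exists>g :: nat \<Rightarrow> ('a \<Rightarrow> int) \<Rightarrow> rat.
     \<forall>\<alpha>. (\<forall>i\<in>I. \<bar>\<alpha> i\<bar> \<le> int D) \<longrightarrow> (\<exists>p. (\<forall>q<Q. polyfn I (c * D) (p q)) \<and>
       (\<forall>z. F (\<lambda>i. z i + \<alpha> i) = (\<Sum>q<Q. g q z * p q z)))" unfolding tame_def by blast
  define M where "M = card I'"
  have finI': "finite I'" using assms by simp
  have cardI: "card I = Suc M"
    unfolding M_def I'_def using assms by (metis card_Suc_Diff1)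
  \<comment> \<open>The count needs
    \<open>Q * (c * D + D + 1) ^ Suc M < (D + 1) ^ Suc (Suc M)\<close>. Since
    \<open>c * D + D + 1 \<le> (c + 2) * (D + 1)\<close>, it is enough that
    \<open>Q * (c + 2) ^ Suc M\<close> is less than \<open>D + 1\<close>.\<close>
  define D where "D = Q * (c + 2) ^ Suc M"
  from tm[of D] obtain g where "\<And>\<alpha>. (\<forall>i\<in>I. \<bar>\<alpha> i\<bar> \<le> int D) \<Longrightarrow>
     (\<exists>p. (\<forall>q<Q. polyfn I (c * D) (p q)) \<and> (\<forall>z. F (\<lambda>i. z i + \<alpha> i) = (\<Sum>q<Q. g q z * p q z)))"
    by blast
  then obtain P where P: "\<And>\<alpha> q. (\<forall>i\<in>I. \<bar>\<alpha> i\<bar> \<le> int D) \<Longrightarrow> q < Q \<Longrightarrow> polyfn I (c * D) (P \<alpha> q)"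
    "\<And>\<alpha> z. (\<forall>i\<in>I. \<bar>\<alpha> i\<bar> \<le> int D) \<Longrightarrow> F (\<lambda>i. z i + \<alpha> i) = (\<Sum>q<Q. g q z * P \<alpha> q z)"
    by metis
  define J where "J = {..D} \<times> {..D} \<times> (I' \<rightarrow>\<^sub>E {..D})"
  define E where "E = (I \<rightarrow>\<^sub>E {..c * D + D})"
  define V where "V = (\<lambda>(i, j, \<beta>) z. of_int (z i0) ^ i *
       (\<Sum>\<alpha>\<in>PiE I' (\<lambda>v. {..\<beta> v}). diff_coeff I' \<beta> \<alpha> * F (\<lambda>i. z i + fwd_shift I i0 j \<alpha> i)))"
  \<comment> \<open>\<open>R t q\<close> is the polynomial coefficient of \<open>g q\<close> in
    \<open>V t\<close>; its degree is at most \<open>c * D\<close> from tameness plus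
    \<open>D\<close> from the power of \<open>n\<close>.\<close>
  define R where "R = (\<lambda>(i, j, \<beta>) q z. of_int (z i0) ^ i *
       (\<Sum>\<alpha>\<in>PiE I' (\<lambda>v. {..\<beta> v}). diff_coeff I' \<beta> \<alpha> * P (fwd_shift I i0 j \<alpha>) q z))"
  have small: "\<forall>i\<in>I. \<bar>fwd_shift I i0 j \<alpha> i\<bar> \<le> int D"
    if "(i, j, \<beta>) \<in> J" "\<alpha> \<in> PiE I' (\<lambda>v. {..\<beta> v})" for i j \<beta> \<alpha>
  proof
    fix v assume "v \<in> I"
    show "\<bar>fwd_shift I i0 j \<alpha> v\<bar> \<le> int D"
    proof (cases "v = i0")
      case False
      with \<open>v \<in> I\<close> have "v \<in> I'" by (simp add: I'_def)
      with that have "\<alpha> v \<le> \<beta> v" "\<beta> v \<le> D" by (auto simp: J_def)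
      with False show ?thesis by auto
    qed (use that in \<open>auto simp: J_def\<close>)
  qed
  have VR: "V t z = (\<Sum>q<Q. g q z * R t q z)" if "t \<in> J" for t z
  proof -
    obtain i j \<beta> where t: "t = (i, j, \<beta>)" by (cases t) auto
    have "V t z = of_int (z i0) ^ i * (\<Sum>\<alpha>\<in>PiE I' (\<lambda>v. {..\<beta> v}). diff_coeff I' \<beta> \<alpha> *
        (\<Sum>q<Q. g q z * P (fwd_shift I i0 j \<alpha>) q z))"
      unfolding V_def t prod.case using small that t
      by (intro arg_cong2[where f = "(*)"] refl sum.cong P(2)) blast+
    also have "\<dots> = (\<Sum>q<Q. g q z * R t q z)"
      unfolding R_def t prod.case sum_distrib_left
      by (subst sum.swap) (simp add: mult_ac)
    finally show ?thesis .
  qed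
  have "polyfn I (c * D + D) (R t q)" if "t \<in> J" "q < Q" for t q
  proof -
    obtain i j \<beta> where t: "t = (i, j, \<beta>)" by (cases t) auto
    have "polyfn I (i + c * D) (R t q)"
      unfolding R_def t prod.case using small that t assms(3)
      by (intro polyfn_mult polyfn_power_var polyfn_sum polyfn_smult P(1)) blast+
    moreover have "i + c * D \<le> c * D + D" using that t by (auto simp: J_def)
    ultimately show ?thesis by (rule polyfn_mono)
  qed
  then have "\<exists>w. \<forall>z. R t q z = (\<Sum>e\<in>E. w e * mono_fn I e z)" if "t \<in> J" "q < Q" for t q
    unfolding E_def using polyfn_monomials[OF assms(2)] that by blast
  then obtain A where A: "\<And>t q z. t \<in> J \<Longrightarrow> q < Q \<Longrightarrow> R t q z = (\<Sum>e\<in>E. A t q e * mono_fn I e z)"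
    by metis
  define B where "B = {..<Q} \<times> E"
  have fin: "finite B" "finite J" "finite E"
    using assms finI' by (auto simp: B_def J_def E_def intro!: finite_PiE)
  have "card B = Q * (c * D + D + 1) ^ Suc M"
    using assms(2) by (simp add: B_def E_def card_PiE card_cartesian_product cardI)
  also have "\<dots> \<le> Q * ((c + 2) * (D + 1)) ^ Suc M"
    by (intro mult_le_mono2 power_mono) auto
  also have "\<dots> = D * (D + 1) ^ Suc M"
    unfolding power_mult_distrib by (simp add: D_def)
  also have "\<dots> < (D + 1) * (D + 1) ^ Suc M" by simp
  also have "\<dots> = card J"
    using finI' by (simp add: J_def card_PiE card_cartesian_product M_def)
  finally have "card B < card J" .
  \<comment> \<open>The unknowns are the weights of the functions \<open>V t\<close>. There is one
    equation for each pair of a function \<open>g q\<close> and a monomial, asking that its total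
    coefficient vanish.\<close>
  from underdetermined_system[OF fin(1,2) this, of "\<lambda>b t. A t (fst b) (snd b)"]
  obtain p where p: "\<exists>t\<in>J. p t \<noteq> 0" "\<And>q e. q < Q \<Longrightarrow> e \<in> E \<Longrightarrow> (\<Sum>t\<in>J. p t * A t q e) = 0"
    by (auto simp: B_def)
  have "(\<Sum>t\<in>J. p t * V t z) = 0" for z
  proof -
    have "(\<Sum>t\<in>J. p t * V t z) = (\<Sum>t\<in>J. \<Sum>q<Q. \<Sum>e\<in>E. g q z * mono_fn I e z * (p t * A t q e))"
      by (rule sum.cong) (simp_all add: VR A sum_distrib_left mult_ac)
    also have "\<dots> = (\<Sum>q<Q. \<Sum>e\<in>E. g q z * mono_fn I e z * (\<Sum>t\<in>J. p t * A t q e))"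
      by (simp add: sum_distrib_left sum.swap[of _ J])
    also have "\<dots> = 0" by (simp add: p(2))
    finally show ?thesis .
  qed
  then have "(\<Sum>(i, j, \<beta>) \<in> J. p (i, j, \<beta>) * (of_int (z i0) ^ i *
       (\<Sum>\<alpha>\<in>PiE I' (\<lambda>v. {..\<beta> v}). diff_coeff I' \<beta> \<alpha> * F (\<lambda>i. z i + fwd_shift I i0 j \<alpha> i)))) = 0" for z
    unfolding V_def by (simp add: case_prod_unfold)
  with p(1) show ?thesis unfolding J_def by (rule that)
qed

text \<open>Since \<open>F\<close> vanishes off the box, summing the dependency against a weight
  over a larger box moves all differences to the weight. With a weight adapted to a minimal
  \<open>e\<close>, each term disappears or becomes a power of \<open>n\<close> times a shift of the
  sum.\<close>

theorem holonomic_tame_sum: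
  assumes tm: "tame I F" and fin: "finite I" and i0: "i0 \<in> I"
  defines "I' \<equiv> I - {i0}"
  assumes supp: "\<And>n z. z \<in> extensional I' \<Longrightarrow> z \<notin> I' \<rightarrow>\<^sub>E {0..int n} \<Longrightarrow> F (z(i0 := int n)) = 0"
  shows "holonomic (\<lambda>n. \<Sum>z\<in>I' \<rightarrow>\<^sub>E {0..int n}. F (z(i0 := int n)))"
proof -
  define a where "a n = (\<Sum>z\<in>I' \<rightarrow>\<^sub>E {0..int n}. F (z(i0 := int n)))" for n
  have finI': "finite I'" using fin by (simp add: I'_def)
  from tame_relation[OF tm fin i0, folded I'_def] obtain D p where
    p: "\<exists>t \<in> {..D} \<times> {..D} \<times> (I' \<rightarrow>\<^sub>E {..D}). p t \<noteq> 0"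
    and rel: "\<And>z. (\<Sum>(i, j, \<beta>) \<in> {..D} \<times> {..D} \<times> (I' \<rightarrow>\<^sub>E {..D}). p (i, j, \<beta>) * (of_int (z i0) ^ i *
       (\<Sum>\<alpha>\<in>PiE I' (\<lambda>v. {..\<beta> v}). diff_coeff I' \<beta> \<alpha> * F (\<lambda>i. z i + fwd_shift I i0 j \<alpha> i)))) = 0"
    by blast
  define J where "J = {..D} \<times> {..D} \<times> (I' \<rightarrow>\<^sub>E {..D})"
  define deg where "deg \<beta> = sum \<beta> I'" for \<beta> :: "'a \<Rightarrow> nat"
  from p obtain t where "t \<in> J \<and> p t \<noteq> 0" by (auto simp: J_def)
  from ex_has_least_nat[of "\<lambda>t. t \<in> J \<and> p t \<noteq> 0", OF this, of "\<lambda>t. deg (snd (snd t))"]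
  obtain i1 j1 e where e: "(i1, j1, e) \<in> J" "p (i1, j1, e) \<noteq> 0"
    and min: "\<And>i j \<beta>. (i, j, \<beta>) \<in> J \<Longrightarrow> p (i, j, \<beta>) \<noteq> 0 \<Longrightarrow> deg e \<le> deg \<beta>"
    by (metis prod_cases3 snd_conv)
  have e_PiE: "e \<in> I' \<rightarrow>\<^sub>E {..D}" using e by (simp add: J_def)
  \<comment> \<open>Because of the minus sign, moving \<open>z\<close> back by
    \<open>\<alpha>\<close> moves the upper argument of the binomial coefficient forward, so that
    \<open>gchoose_difference\<close> applies.\<close>
  define w where "w z = (\<Prod>v\<in>I'. (- of_int (z v)) gchoose e v :: rat)" for z :: "'a \<Rightarrow> int"

  \<comment> \<open>The radius \<open>n + 2 * D\<close> leaves one \<open>D\<close> for the shift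
    \<open>j\<close> of \<open>n\<close> and another for the shifts
    \<open>\<alpha> v\<close>.\<close>
  have summed: "(\<Sum>z\<in>I' \<rightarrow>\<^sub>E {-(int n + 2 * int D)..int n + 2 * int D}. w z *
      (\<Sum>\<alpha>\<in>PiE I' (\<lambda>v. {..\<beta> v}). diff_coeff I' \<beta> \<alpha> * F (\<lambda>i. (z(i0 := int n)) i + fwd_shift I i0 j \<alpha> i)))
      = (\<Sum>z\<in>I' \<rightarrow>\<^sub>E {0..int (n + j)}. F (z(i0 := int (n + j))) *
          (\<Prod>v\<in>I'. if \<beta> v \<le> e v then (- of_int (z v)) gchoose (e v - \<beta> v) else 0))"
    (is "?lhs = ?rhs") if j: "j \<le> D" and \<beta>: "\<beta> \<in> I' \<rightarrow>\<^sub>E {..D}" for n j \<beta>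
  proof -
    let ?R = "int n + 2 * int D"
    let ?S = "PiE I' (\<lambda>v. {..\<beta> v})"
    let ?f = "\<lambda>z. F (z(i0 := int (n + j)))"
    have "?lhs = (\<Sum>\<alpha>\<in>?S. diff_coeff I' \<beta> \<alpha> * (\<Sum>z\<in>I' \<rightarrow>\<^sub>E {-?R..?R}. w z *
        ?f (\<lambda>i. if i \<in> I' then z i + int (\<alpha> i) else z i)))"
    proof -
      have "(\<lambda>i. (z(i0 := int n)) i + fwd_shift I i0 j \<alpha> i) =
          (\<lambda>i. if i \<in> I' then z i + int (\<alpha> i) else z i)(i0 := int (n + j))" for z and \<alpha> :: "'a \<Rightarrow> nat"
        using i0 by (auto simp: I'_def)
      then show ?thesis
        by (simp add: sum_distrib_left sum.swap[of _ ?S] mult_ac)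
    qed
    also have "\<dots> = (\<Sum>\<alpha>\<in>?S. diff_coeff I' \<beta> \<alpha> * (\<Sum>z\<in>I' \<rightarrow>\<^sub>E {0..int (n + j)}.
        w (\<lambda>i. if i \<in> I' then z i - int (\<alpha> i) else z i) * ?f z))"
    proof (rule sum.cong[OF refl], rule arg_cong2[where f = "(*)", OF refl])
      fix \<alpha> assume \<alpha>: "\<alpha> \<in> ?S"
      have "0 \<le> int (\<alpha> v) \<and> int (\<alpha> v) \<le> ?R - int (n + j)" if "v \<in> I'" for v
      proof -
        have "\<alpha> v \<le> \<beta> v" "\<beta> v \<le> D" using \<alpha> \<beta> that by auto
        then show ?thesis using j by simp
      qed
      then show "(\<Sum>z\<in>I' \<rightarrow>\<^sub>E {-?R..?R}. w z * ?f (\<lambda>i. if i \<in> I' then z i + int (\<alpha> i) else z i)) =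
          (\<Sum>z\<in>I' \<rightarrow>\<^sub>E {0..int (n + j)}. w (\<lambda>i. if i \<in> I' then z i - int (\<alpha> i) else z i) * ?f z)"
        using finI' j
        by (intro sum_PiE_shift[where a = "\<lambda>i. int (\<alpha> i)" and f = ?f and w = w] supp) auto
    qed
    also have "\<dots> = (\<Sum>z\<in>I' \<rightarrow>\<^sub>E {0..int (n + j)}. ?f z *
        (\<Sum>\<alpha>\<in>?S. diff_coeff I' \<beta> \<alpha> * w (\<lambda>i. if i \<in> I' then z i - int (\<alpha> i) else z i)))"
      by (simp add: sum_distrib_left sum.swap[of _ ?S] mult_ac)
    also have "\<dots> = ?rhs"
    proof (intro sum.cong refl arg_cong2[where f = "(*)"])
      fix z
      have "(\<Sum>\<alpha>\<in>?S. diff_coeff I' \<beta> \<alpha> * w (\<lambda>i. if i \<in> I' then z i - int (\<alpha> i) else z i)) =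
        (\<Sum>\<alpha>\<in>?S. \<Prod>v\<in>I'. (- 1) ^ (\<beta> v - \<alpha> v) * of_nat (\<beta> v choose \<alpha> v) *
            ((- of_int (z v) + of_nat (\<alpha> v)) gchoose e v))"
        by (simp add: w_def flip: prod.distrib)
      also have "\<dots> = (\<Prod>v\<in>I'. \<Sum>a\<le>\<beta> v. (- 1) ^ (\<beta> v - a) * of_nat (\<beta> v choose a) *
            ((- of_int (z v) + of_nat a) gchoose e v))"
        by (rule prod_sum_PiE[symmetric]) (use finI' in auto)
      finally show "(\<Sum>\<alpha>\<in>?S. diff_coeff I' \<beta> \<alpha> * w (\<lambda>i. if i \<in> I' then z i - int (\<alpha> i) else z i)) =
        (\<Prod>v\<in>I'. if \<beta> v \<le> e v then (- of_int (z v)) gchoose (e v - \<beta> v) else 0)"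
        by (simp only: gchoose_difference)
    qed
    finally show ?thesis .
  qed

  define r where "r j \<beta> n = (\<Sum>z\<in>I' \<rightarrow>\<^sub>E {0..int (n + j)}. F (z(i0 := int (n + j))) *
          (\<Prod>v\<in>I'. if \<beta> v \<le> e v then (- of_int (z v)) gchoose (e v - \<beta> v) else 0))" for j \<beta> n
  have r_e: "r j e n = a (n + j)" for j n
    by (simp add: r_def a_def)
  have r_other: "p (i, j, \<beta>) * r j \<beta> n = 0" if tJ: "(i, j, \<beta>) \<in> J" and ne: "\<beta> \<noteq> e" for i j \<beta> n
  proof (cases "p (i, j, \<beta>) = 0")
    case False
    \<comment> \<open>Otherwise \<open>\<beta>\<close> would lie strictly below \<open>e\<close> and
      contradict minimality. In a coordinate where \<open>\<beta>\<close> exceeds \<open>e\<close>,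
      the difference annihilates the weight.\<close>
    have "\<exists>v\<in>I'. \<beta> v > e v"
    proof (rule ccontr)
      assume "\<not> ?thesis"
      then have le: "\<And>v. v \<in> I' \<Longrightarrow> \<beta> v \<le> e v" by force
      have "\<beta> \<in> I' \<rightarrow>\<^sub>E {..D}" using tJ by (simp add: J_def)
      then obtain v where "v \<in> I'" "\<beta> v \<noteq> e v" using ne e_PiE by (meson PiE_ext)
      then have "sum \<beta> I' < sum e I'" using le finI' by (intro sum_strict_mono_ex1) (auto simp: order.strict_iff_order)
      with min[OF tJ False] show False by (simp add: deg_def)
    qed
    then obtain v where v: "v \<in> I'" "\<not> \<beta> v \<le> e v" by auto
    have "(\<Prod>v\<in>I'. if \<beta> v \<le> e v then (- of_int (z v)) gchoose (e v - \<beta> v) else 0 :: rat) = 0" for z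
      using v finI' by (intro prod_zero) auto
    then show ?thesis by (simp add: r_def)
  qed simp

  define c where "c j = (\<Sum>i\<le>D. monom (p (i, j, e)) i)" for j
  have "(\<Sum>j\<le>D. poly (c j) (of_nat n) * a (n + j)) = 0" for n
  proof -
    let ?Z = "I' \<rightarrow>\<^sub>E {-(int n + 2 * int D)..int n + 2 * int D}"
    have "0 = (\<Sum>z\<in>?Z. w z * (\<Sum>(i, j, \<beta>) \<in> J. p (i, j, \<beta>) * (of_int ((z(i0 := int n)) i0) ^ i *
       (\<Sum>\<alpha>\<in>PiE I' (\<lambda>v. {..\<beta> v}). diff_coeff I' \<beta> \<alpha> * F (\<lambda>i. (z(i0 := int n)) i + fwd_shift I i0 j \<alpha> i)))))"
      unfolding J_def rel by simp
    also have "\<dots> = (\<Sum>(i, j, \<beta>) \<in> J. p (i, j, \<beta>) * (of_nat n ^ i * (\<Sum>z\<in>?Z. w z *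
       (\<Sum>\<alpha>\<in>PiE I' (\<lambda>v. {..\<beta> v}). diff_coeff I' \<beta> \<alpha> * F (\<lambda>i. (z(i0 := int n)) i + fwd_shift I i0 j \<alpha> i)))))"
      unfolding sum_distrib_left case_prod_unfold
      by (subst sum.swap) (simp add: sum_distrib_left mult_ac)
    also have "\<dots> = (\<Sum>(i, j, \<beta>) \<in> J. p (i, j, \<beta>) * (of_nat n ^ i * r j \<beta> n))"
    proof (rule sum.cong[OF refl], goal_cases)
      case (1 t)
      obtain i j \<beta> where t: "t = (i, j, \<beta>)" by (cases t) auto
      with 1 have "j \<le> D" "\<beta> \<in> I' \<rightarrow>\<^sub>E {..D}" by (auto simp: J_def)
      then show ?case unfolding t prod.case r_def by (subst summed) simp_all
    qed
    also have "\<dots> = (\<Sum>(i, j, \<beta>) \<in> {..D} \<times> {..D} \<times> {e}. p (i, j, \<beta>) * (of_nat n ^ i * r j \<beta> n))"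
    proof (rule sum.mono_neutral_right)
      show "\<forall>t\<in>J - {..D} \<times> {..D} \<times> {e}. (case t of (i, j, \<beta>) \<Rightarrow> p (i, j, \<beta>) * (of_nat n ^ i * r j \<beta> n)) = 0"
        using r_other by (fastforce simp: J_def)
    qed (use e_PiE finI' in \<open>auto simp: J_def intro: finite_PiE\<close>)
    also have "\<dots> = (\<Sum>i\<le>D. \<Sum>j\<le>D. p (i, j, e) * (of_nat n ^ i * r j e n))"
      by (simp add: sum.cartesian_product[symmetric])
    also have "\<dots> = (\<Sum>j\<le>D. \<Sum>i\<le>D. p (i, j, e) * (of_nat n ^ i * r j e n))"
      by (rule sum.swap)
    also have "\<dots> = (\<Sum>j\<le>D. poly (c j) (of_nat n) * a (n + j))"
      by (simp add: c_def poly_sum poly_monom r_e sum_distrib_left mult_ac)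
    finally show ?thesis by simp
  qed
  \<comment> \<open>The recurrence is nontrivial because the nonzero weight at
    \<open>(i1, j1, e)\<close> survives as a coefficient of \<open>c j1\<close>.\<close>
  moreover have "c j1 \<noteq> 0"
  proof -
    have "coeff (c j1) i1 = p (i1, j1, e)"
      using e(1) by (simp add: c_def coeff_sum J_def)
    with e(2) show ?thesis by auto
  qed
  moreover have "j1 \<le> D" using e(1) by (simp add: J_def)
  ultimately show ?thesis unfolding holonomic_def a_def[symmetric] by blast
qed

section \<open>Counting arrangements of blocks\<close>

text \<open>Orderings of \<open>A\<close>, given by ranks counted from 0, in which \<open>y\<close>
  comes immediately after \<open>x\<close> for every \<open>(x, y)\<close> in
  \<open>R\<close>.\<close>

definition chain_maps :: "'a set \<Rightarrow> ('a \<times> 'a) set \<Rightarrow> ('a \<Rightarrow> nat) set" where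
  "chain_maps A R =
     {f \<in> A \<rightarrow>\<^sub>E {..<card A}. inj_on f A \<and> (\<forall>(x, y)\<in>R. f y = Suc (f x))}"

lemma card_chain_maps_empty:
  assumes "finite A"
  shows "card (chain_maps A {}) = fact (card A)"
proof -
  have "card (chain_maps A {}) = card {f \<in> A \<rightarrow>\<^sub>E {..<card A}. inj_on f A}"
    by (simp add: chain_maps_def)
  also have "\<dots> = fact (card A)"
    using assms by (subst card_inj_on_subset_funcset) (auto simp: fact_prod_rev)
  finally show ?thesis .
qed

text \<open>As \<open>x\<close> has no prescribed successor, \<open>y\<close> can be inserted
  directly after it in exactly one way without separating a linked pair. The map \<open>up\<close>
  opens the gap and \<open>dn\<close> closes it.\<close>

lemma card_chain_maps_insert:
  assumes fin: "finite A" and R: "R \<subseteq> A \<times> A" and y: "y \<notin> A" and x: "x \<in> A" "x \<notin> Domain R"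
  shows "card (chain_maps (insert y A) (insert (x, y) R)) = card (chain_maps A R)"
proof -
  define up where "up f = (\<lambda>a\<in>insert y A. if a = y then Suc (f x)
      else if f a \<le> f x then f a else Suc (f a))" for f :: "'a \<Rightarrow> nat"
  define dn where "dn f = (\<lambda>a\<in>A. if f a \<le> f x then f a else f a - 1)" for f :: "'a \<Rightarrow> nat"
  have yx: "y \<noteq> x" using x y by auto
  have card: "card (insert y A) = Suc (card A)" using fin y by simp
  have up_y: "up f y = Suc (f x)" for f by (simp add: up_def)
  have up_A: "up f a = (if f a \<le> f x then f a else Suc (f a))" if "a \<in> A" for f a
    using that y by (auto simp: up_def)
  have dn_A: "dn f a = (if f a \<le> f x then f a else f a - 1)" if "a \<in> A" for f a
    using that by (simp add: dn_def)
  have up_in: "up f \<in> chain_maps (insert y A) (insert (x, y) R)" if "f \<in> chain_maps A R" for f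
  proof -
    from that have f: "\<And>a. a \<in> A \<Longrightarrow> f a < card A" "inj_on f A"
      "\<And>a b. (a, b) \<in> R \<Longrightarrow> f b = Suc (f a)" by (auto simp: chain_maps_def)
    have neq: "f a \<noteq> f x" if "a \<in> A" "a \<noteq> x" for a using f(2) x that by (auto dest: inj_onD)
    have "up f \<in> insert y A \<rightarrow>\<^sub>E {..<card (insert y A)}"
      unfolding card using f(1) f(1)[THEN less_SucI] x by (auto simp: up_def)
    moreover have "inj_on (up f) (insert y A)"
    proof (subst inj_on_insert, intro conjI inj_onI)
      fix a b assume ab: "a \<in> A" "b \<in> A" "up f a = up f b"
      then have "f a = f b" by (auto simp: up_A split: if_splits)
      then show "a = b" using f(2) ab by (auto dest: inj_onD)
    next
      show "up f y \<notin> up f ` (A - {y})"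
        using neq by (auto simp: up_y up_A split: if_splits)
    qed
    moreover have "up f b = Suc (up f a)" if "(a, b) \<in> R" for a b
    proof -
      have "a \<in> A" "b \<in> A" "a \<noteq> x" using that R x by auto
      with f(3)[OF that] neq[of a] show ?thesis by (auto simp: up_A)
    qed
    moreover have "up f y = Suc (up f x)" using x by (simp add: up_y up_A)
    ultimately show ?thesis by (auto simp: chain_maps_def)
  qed
  have dn_in: "dn f \<in> chain_maps A R"
    and up_dn: "up (dn f) = f" if "f \<in> chain_maps (insert y A) (insert (x, y) R)" for f
  proof -
    from that have f: "\<And>a. a \<in> insert y A \<Longrightarrow> f a < Suc (card A)" "inj_on f (insert y A)"
      "\<And>a b. (a, b) \<in> R \<Longrightarrow> f b = Suc (f a)" "f y = Suc (f x)" and ext: "f \<in> extensional (insert y A)"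
      by (auto simp: chain_maps_def card PiE_iff)
    have neq: "f a \<noteq> f x" if "a \<in> A" "a \<noteq> x" for a using f(2) x that by (auto dest: inj_onD)
    \<comment> \<open>The rank just above \<open>x\<close> is occupied by \<open>y\<close>, so
      closing the gap merges no two ranks.\<close>
    have neq': "f a \<noteq> Suc (f x)" if "a \<in> A" for a
      using inj_onD[OF f(2), of a y] y that unfolding f(4)[symmetric] by auto
    have lt: "f x < card A" using f(1)[of y] f(4) by simp
    have "dn f \<in> A \<rightarrow>\<^sub>E {..<card A}"
      using f(1) lt by (force simp: dn_def)
    moreover have "inj_on (dn f) A"
    proof (rule inj_onI)
      fix a b assume ab: "a \<in> A" "b \<in> A" "dn f a = dn f b"
      with neq'[OF ab(1)] neq'[OF ab(2)] have "f a = f b" by (auto simp: dn_A split: if_splits)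
      then show "a = b" using f(2) ab by (auto dest: inj_onD)
    qed
    moreover have "dn f b = Suc (dn f a)" if "(a, b) \<in> R" for a b
    proof -
      have "a \<in> A" "b \<in> A" "a \<noteq> x" using that R x by auto
      with f(3)[OF that] neq[of a] show ?thesis by (auto simp: dn_A)
    qed
    ultimately show "dn f \<in> chain_maps A R" by (auto simp: chain_maps_def)
    show "up (dn f) = f"
    proof
      fix a
      consider "a = y" | "a \<in> A" | "a \<notin> insert y A" by blast
      then show "up (dn f) a = f a"
      proof cases
        case 1
        then show ?thesis using x f(4) by (simp add: up_y dn_A)
      next
        case 2
        with neq'[of a] x show ?thesis by (auto simp: up_A dn_A)
      next
        case 3
        with ext show ?thesis by (auto simp: up_def extensional_def)
      qed
    qed
  qed
  have dn_up: "dn (up f) = f" if "f \<in> chain_maps A R" for f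
  proof
    fix a
    show "dn (up f) a = f a"
    proof (cases "a \<in> A")
      case True
      with x show ?thesis by (auto simp: up_A dn_A)
    next
      case False
      with that show ?thesis by (auto simp: dn_def chain_maps_def PiE_iff extensional_def)
    qed
  qed
  have "bij_betw up (chain_maps A R) (chain_maps (insert y A) (insert (x, y) R))"
    by (rule bij_betw_byWitness[where f' = dn]) (use up_in dn_in up_dn dn_up in auto)
  then show ?thesis by (rule bij_betw_same_card[symmetric])
qed

text \<open>Reading an ordering backwards turns immediate successors into immediate
  predecessors.\<close>

lemma card_chain_maps_converse:
  assumes "R \<subseteq> A \<times> A"
  shows "card (chain_maps A (R\<inverse>)) = card (chain_maps A R)"
proof -
  define rf where "rf f = (\<lambda>a\<in>A. card A - Suc (f a))" for f :: "'a \<Rightarrow> nat"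
  have rf_in: "rf f \<in> chain_maps A (R\<inverse>)" and rf_rf: "rf (rf f) = f"
    if R: "R \<subseteq> A \<times> A" and f: "f \<in> chain_maps A R" for f R
  proof -
    from f have f: "\<And>a. a \<in> A \<Longrightarrow> f a < card A" "inj_on f A" "f \<in> extensional A"
      "\<And>a b. (a, b) \<in> R \<Longrightarrow> f b = Suc (f a)" by (auto simp: chain_maps_def PiE_iff)
    have "inj_on (rf f) A"
    proof (rule inj_onI)
      fix a b assume ab: "a \<in> A" "b \<in> A" "rf f a = rf f b"
      with f(1)[OF ab(1)] f(1)[OF ab(2)] have "f a = f b" by (auto simp: rf_def)
      then show "a = b" using f(2) ab by (auto dest: inj_onD)
    qed
    moreover have "rf f \<in> A \<rightarrow>\<^sub>E {..<card A}" using f(1) by (force simp: rf_def)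
    moreover have "rf f a = Suc (rf f b)" if "(a, b) \<in> R" for a b
    proof -
      have "a \<in> A" "b \<in> A" using that R by auto
      then show ?thesis using f(4)[OF that] f(1)[of b] by (simp add: rf_def)
    qed
    ultimately show "rf f \<in> chain_maps A (R\<inverse>)" by (auto simp: chain_maps_def)
    show "rf (rf f) = f"
    proof
      fix a
      show "rf (rf f) a = f a"
        using f(1)[of a] f(3) by (cases "a \<in> A") (auto simp: rf_def extensional_def)
    qed
  qed
  have R': "R\<inverse> \<subseteq> A \<times> A" using assms by auto
  have "bij_betw rf (chain_maps A R) (chain_maps A (R\<inverse>))"
    by (rule bij_betw_byWitness[where f' = rf])
      (use rf_in[OF assms] rf_in[OF R'] rf_rf[OF assms] rf_rf[OF R'] in auto)
  then show ?thesis by (rule bij_betw_same_card[symmetric])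
qed

lemma card_chain_maps_insert':
  assumes "finite A" "R \<subseteq> A \<times> A" "y \<notin> A" "x \<in> A" "x \<notin> Range R"
  shows "card (chain_maps (insert y A) (insert (y, x) R)) = card (chain_maps A R)"
proof -
  have "card (chain_maps (insert y A) (insert (y, x) R)) =
      card (chain_maps (insert y A) ((insert (y, x) R)\<inverse>))"
    using assms by (intro card_chain_maps_converse[symmetric]) auto
  also have "(insert (y, x) R)\<inverse> = insert (x, y) (R\<inverse>)" by auto
  also have "card (chain_maps (insert y A) \<dots>) = card (chain_maps A (R\<inverse>))"
    using assms by (intro card_chain_maps_insert) auto
  also have "\<dots> = card (chain_maps A R)"
    using assms by (intro card_chain_maps_converse) auto
  finally show ?thesis .
qed

text \<open>Ranks within a value class are values divided by \<open>s\<close>. Mode 1 makes the rank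
  at \<open>i\<close> one larger than at \<open>i - r\<close>, mode 2 one smaller.\<close>

definition links :: "nat \<Rightarrow> nat set \<Rightarrow> (nat \<Rightarrow> nat) \<Rightarrow> (nat \<times> nat) set" where
  "links r A m = {(i - r, i) | i. i \<in> A \<and> m i = 1} \<union> {(i, i - r) | i. i \<in> A \<and> m i = 2}"

text \<open>Linked positions form rigid blocks, each with exactly one position of mode 0, so the
  orderings are those of the blocks. The proof removes the largest position of nonzero mode, which
  is the end of its block.\<close>

lemma card_chain_maps_links:
  assumes "finite A" "r \<ge> 1"
    and "\<And>i. i \<in> A \<Longrightarrow> m i \<noteq> 0 \<Longrightarrow>
      r < i \<and> i - r \<in> A \<and> m i \<in> {1, 2} \<and> m (i - r) \<in> {0, m i}"
  shows "card (chain_maps A (links r A m)) = fact (card {i\<in>A. m i = 0})"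
  using assms(1,3)
proof (induction "card {i\<in>A. m i \<noteq> 0}" arbitrary: A)
  case 0
  then have 0: "\<And>i. i \<in> A \<Longrightarrow> m i = 0" by auto
  then have "links r A m = {}" by (auto simp: links_def)
  moreover have "{i\<in>A. m i = 0} = A" using 0 by auto
  ultimately show ?case using 0 "0.prems"(1) by (simp add: card_chain_maps_empty)
next
  case (Suc k)
  define B where "B = {i\<in>A. m i \<noteq> 0}"
  have "card B = Suc k" using Suc.hyps(2) by (simp add: B_def)
  then have B: "finite B" "B \<noteq> {}" by (metis card.infinite Zero_not_Suc, metis card.empty Zero_not_Suc)
  define y where "y = Max B"
  have yB: "y \<in> B" unfolding y_def using B by (rule Max_in)
  have le: "i \<le> y" if "i \<in> B" for i unfolding y_def using B(1) that by (rule Max_ge)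
  define x where "x = y - r"
  from yB have y: "y \<in> A" "m y \<noteq> 0" by (auto simp: B_def)
  from Suc.prems(2)[OF this] have x: "r < y" "x \<in> A" "m y \<in> {1, 2}" "m x \<in> {0, m y}"
    by (auto simp: x_def)
  have xy: "x < y" using x(1) assms(2) by (auto simp: x_def)
  define A' where "A' = A - {y}"
  have A: "A = insert y A'" "y \<notin> A'" "finite A'" "x \<in> A'"
    using y x xy Suc.prems(1) by (auto simp: A'_def)
  have valid: "r < i \<and> i - r \<in> A' \<and> m i \<in> {1, 2} \<and> m (i - r) \<in> {0, m i}"
    if "i \<in> A'" "m i \<noteq> 0" for i
  proof -
    have iB: "i \<in> B" "i \<in> A" using that by (auto simp: B_def A'_def)
    from Suc.prems(2)[OF iB(2) that(2)] have "r < i \<and> i - r \<in> A \<and> m i \<in> {1, 2} \<and> m (i - r) \<in> {0, m i}" .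
    moreover from this have "i - r \<noteq> y" using le[OF iB(1)] assms(2) by linarith
    ultimately show ?thesis by (auto simp: A'_def)
  qed
  have "B = insert y {i\<in>A'. m i \<noteq> 0}" using yB by (auto simp: B_def A'_def)
  then have "card B = Suc (card {i\<in>A'. m i \<noteq> 0})" using A by simp
  with Suc.hyps(2) have k: "k = card {i\<in>A'. m i \<noteq> 0}" by (simp add: B_def)
  have R: "links r A' m \<subseteq> A' \<times> A'"
    unfolding links_def using valid by auto
  \<comment> \<open>No other position attaches to \<open>x\<close> from above, and the mode of
    \<open>x\<close> is 0 or that of \<open>y\<close>. Hence the side of \<open>x\<close> on which
    \<open>y\<close> is attached is free.\<close>
  have nlink: "i - r \<noteq> x" if "i \<in> A'" "m i \<noteq> 0" for i
  proof
    assume "i - r = x"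
    then have "i = y" using valid[OF that] x(1) by (simp add: x_def)
    then show False using that A(2) by simp
  qed
  have "card (chain_maps A (links r A m)) = card (chain_maps A' (links r A' m))"
  proof (cases "m y = 1")
    case True
    have "links r A m = insert (x, y) (links r A' m)"
      unfolding A(1) links_def using True by (auto simp: x_def)
    moreover have "x \<notin> Domain (links r A' m)"
    proof
      assume "x \<in> Domain (links r A' m)"
      then obtain i where "i \<in> A'" "m i = 1 \<and> x = i - r \<or> m i = 2 \<and> x = i"
        by (auto simp: links_def)
      then show False using nlink[of i] x(4) True by auto
    qed
    ultimately show ?thesis unfolding A(1) using A R by (simp add: card_chain_maps_insert)
  next
    case False
    then have 2: "m y = 2" using x by auto
    then have "links r A m = insert (y, x) (links r A' m)"
      unfolding A(1) links_def by (auto simp: x_def)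
    moreover have "x \<notin> Range (links r A' m)"
    proof
      assume "x \<in> Range (links r A' m)"
      then obtain i where "i \<in> A'" "m i = 2 \<and> x = i - r \<or> m i = 1 \<and> x = i"
        by (auto simp: links_def)
      then show False using nlink[of i] x(4) 2 by auto
    qed
    ultimately show ?thesis unfolding A(1) using A R by (simp add: card_chain_maps_insert')
  qed
  also have "\<dots> = fact (card {i\<in>A'. m i = 0})"
    using k A(3) valid by (rule Suc.hyps(1))
  also have "{i\<in>A'. m i = 0} = {i\<in>A. m i = 0}" using y by (auto simp: A'_def)
  finally show ?case .
qed

section \<open>Inclusion-exclusion over letters\<close>

text \<open>For \<open>v < s\<close> this is the number of \<open>w\<close> in \<open>{1..n}\<close>
  with \<open>w - 1\<close> congruent to \<open>v\<close> modulo \<open>s\<close>, that is,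
  \<open>(n - v) / s\<close> rounded up. Adding \<open>s - 1\<close> first prevents
  truncation.\<close>

definition class_size :: "nat \<Rightarrow> nat \<Rightarrow> nat \<Rightarrow> nat" where
  "class_size s n v = (n + s - 1 - v) div s"

lemma less_class_size_iff:
  assumes "v < s"
  shows "h < class_size s n v \<longleftrightarrow> 1 + v + s * h \<le> n"
proof -
  have "h < class_size s n v \<longleftrightarrow> Suc h * s \<le> n + s - 1 - v"
    unfolding class_size_def Suc_le_eq[symmetric] using assms by (intro less_eq_div_iff_mult_less_eq) auto
  also have "\<dots> \<longleftrightarrow> 1 + v + s * h \<le> n" using assms by (auto simp: algebra_simps)
  finally show ?thesis .
qed

lemma bij_betw_classes:
  assumes "s \<ge> 1"
  shows "bij_betw (\<lambda>(v, h). 1 + v + s * h) (SIGMA v:{..<s}. {..<class_size s n v}) {1..n}"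
proof (rule bij_betw_byWitness[where f' = "\<lambda>w. ((w - 1) mod s, (w - 1) div s)"])
  show "(\<lambda>w. ((w - 1) mod s, (w - 1) div s)) ` {1..n} \<subseteq> (SIGMA v:{..<s}. {..<class_size s n v})"
    using assms by (auto simp: less_class_size_iff)
qed (use assms in \<open>auto simp: less_class_size_iff\<close>)

lemma prod_classes:
  fixes g :: "nat \<Rightarrow> 'a::comm_monoid_mult"
  assumes "s \<ge> 1"
  shows "(\<Prod>i\<in>{1..n}. g i) = (\<Prod>v<s. \<Prod>h<class_size s n v. g (1 + v + s * h))"
  using prod.reindex_bij_betw[OF bij_betw_classes[OF assms, of n], of g]
  by (simp add: prod.Sigma case_prod_unfold)

lemma card_class:
  assumes "v < s"
  shows "card {w\<in>{1..n}. (w - 1) mod s = v} = class_size s n v"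
proof -
  have "bij_betw (\<lambda>h. 1 + v + s * h) {..<class_size s n v} {w\<in>{1..n}. (w - 1) mod s = v}"
    by (rule bij_betw_byWitness[where f' = "\<lambda>w. (w - 1) div s"])
      (use assms in \<open>auto simp: less_class_size_iff\<close>)
  from bij_betw_same_card[OF this] show ?thesis by simp
qed

text \<open>The parameter \<open>e\<close> treats both counts together: 0 for signed and 1 for
  absolute differences. The additive form avoids subtraction on \<open>nat\<close>.\<close>

definition good :: "nat \<Rightarrow> nat \<Rightarrow> nat \<Rightarrow> nat \<Rightarrow> (nat \<Rightarrow> nat) \<Rightarrow> bool" where
  "good e r s n p \<longleftrightarrow> (\<forall>i. 1 \<le> i \<and> i + r \<le> n \<longrightarrow>
     p (i + r) \<noteq> p i + s \<and> (e = 1 \<longrightarrow> p i \<noteq> p (i + r) + s))"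

text \<open>Inclusion-exclusion selects a set of forbidden pairs that do occur. The mode of a position
  says whether the pair it forms with the position \<open>r\<close> places earlier is not selected (0),
  selected as an ascent (1), or selected as a descent (2, only when \<open>e = 1\<close>). A letter
  is the residue class of the value together with the mode.\<close>

definition link :: "nat \<Rightarrow> nat \<Rightarrow> (nat \<Rightarrow> nat) \<Rightarrow> nat \<Rightarrow> nat \<Rightarrow> bool" where
  "link r s p i m \<longleftrightarrow> m = 0 \<or> r < i \<and> (if m = 1 then p i = p (i - r) + s else p (i - r) = p i + s)"

abbreviation letters :: "nat \<Rightarrow> nat \<Rightarrow> (nat \<times> nat) set" where
  "letters s e \<equiv> {..<s} \<times> {..Suc e}"

text \<open>The inclusion-exclusion sign contributed by position \<open>i\<close>, or 0 if the
  letter cannot occur: linked positions share the value class modulo \<open>s\<close>, and a link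
  may not be followed by one of opposite direction.\<close>

definition lwt :: "nat \<Rightarrow> (nat \<Rightarrow> nat \<times> nat) \<Rightarrow> nat \<Rightarrow> rat" where
  "lwt r x i = (if snd (x i) = 0 then 1
     else if r < i \<and> fst (x (i - r)) = fst (x i) \<and> snd (x (i - r)) \<in> {0, snd (x i)} then - 1 else 0)"

context
  fixes r s n e :: nat and x :: "nat \<Rightarrow> nat \<times> nat"
  assumes rs: "r \<ge> 1" "s \<ge> 1" and e: "e \<le> 1" and x: "\<And>i. i \<in> {1..n} \<Longrightarrow> x i \<in> letters s e"
begin

abbreviation "lettered \<equiv> {p. p permutes {1..n} \<and>
  (\<forall>i\<in>{1..n}. fst (x i) = (p i - 1) mod s \<and> link r s p i (snd (x i)))}"

abbreviation "coloured v \<equiv> {i\<in>{1..n}. fst (x i) = v}"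

lemma lettered_lwt_nonzero:
  assumes p: "p \<in> lettered" and i: "i \<in> {1..n}"
  shows "lwt r x i \<noteq> 0"
proof (cases "snd (x i) = 0")
  case False
  have pos: "p j \<in> {1..n}" if "j \<in> {1..n}" for j
    using p that by (auto simp: permutes_in_image simp del: atLeastAtMost_iff)
  have col: "fst (x j) = (p j - 1) mod s" and link: "link r s p j (snd (x j))" if "j \<in> {1..n}" for j
    using p that by auto
  have inj: "p j = p k \<Longrightarrow> j = k" for j k using p by (auto dest: permutes_inj injD)
  have ri: "r < i" using link[OF i] False by (auto simp: link_def)
  then have j: "i - r \<in> {1..n}" using i by auto
  have mode: "snd (x k) \<in> {0, 1, 2}" if "k \<in> {1..n}" for k using x[OF that] e by auto
  have "fst (x (i - r)) = fst (x i)"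
  proof -
    have "p i - 1 = p (i - r) - 1 + s \<or> p (i - r) - 1 = p i - 1 + s"
      using link[OF i] False pos[OF i] pos[OF j] by (auto simp: link_def split: if_splits)
    then show ?thesis unfolding col[OF i] col[OF j] by auto
  qed
  moreover have "snd (x (i - r)) \<in> {0, snd (x i)}"
  proof (rule ccontr)
    assume *: "\<not> ?thesis"
    then have rr: "r < i - r" using link[OF j] by (auto simp: link_def)
    \<comment> \<open>Two consecutive links of opposite direction return to the same value, against
      injectivity.\<close>
    have "p (i - r - r) = p i"
      using link[OF i] link[OF j] False * mode[OF i] mode[OF j] by (auto simp: link_def)
    then show False using inj[of "i - r - r" i] rs ri by auto
  qed
  ultimately show ?thesis using ri False by (auto simp: lwt_def)
qed (simp add: lwt_def)

lemma lettered_card_coloured: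
  assumes p: "p \<in> lettered" and v: "v < s"
  shows "card (coloured v) = class_size s n v"
proof -
  have perm: "p permutes {1..n}" using p by simp
  have "{w\<in>{1..n}. (w - 1) mod s = v} = p ` coloured v"
  proof (intro equalityI subsetI)
    fix w assume w: "w \<in> {w\<in>{1..n}. (w - 1) mod s = v}"
    then have "w \<in> p ` {1..n}" using permutes_image[OF perm] by simp
    then show "w \<in> p ` coloured v" using w p by auto
  next
    fix w assume "w \<in> p ` coloured v"
    then show "w \<in> {w\<in>{1..n}. (w - 1) mod s = v}"
      using p permutes_in_image[OF perm] by force
  qed
  moreover have "inj_on p (coloured v)"
    using permutes_inj_on[OF perm] by (rule inj_on_subset) auto
  ultimately show ?thesis using card_class[OF v, of n] by (simp add: card_image)
qed

text \<open>Once the letters are fixed, a permutation amounts to an independent choice, for each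
  value class, of an ordering of the positions of that colour. Links become adjacency conditions, so
  \<open>card_chain_maps_links\<close> counts each factor.\<close>

lemma card_lettered_valid:
  assumes val: "\<And>i. i \<in> {1..n} \<Longrightarrow> lwt r x i \<noteq> 0"
    and card: "\<And>v. v < s \<Longrightarrow> card (coloured v) = class_size s n v"
  shows "card lettered = (\<Prod>v<s. fact (card {i\<in>{1..n}. x i = (v, 0)}))"
proof -
  define m where "m i = snd (x i)" for i
  have mode: "m i \<in> {0, 1, 2}" if "i \<in> {1..n}" for i using x[OF that] e by (auto simp: m_def)
  have valid: "r < i \<and> i - r \<in> coloured v \<and> m i \<in> {1, 2} \<and> m (i - r) \<in> {0, m i}"
    if "i \<in> coloured v" "m i \<noteq> 0" for i v
    using val[of i] that mode[of i] by (auto simp: lwt_def m_def split: if_splits)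
  define K where "K v = chain_maps (coloured v) (links r (coloured v) m)" for v
  have cardK: "card (K v) = fact (card {i\<in>{1..n}. x i = (v, 0)})" for v
  proof -
    have "card (K v) = fact (card {i \<in> coloured v. m i = 0})"
      unfolding K_def using rs(1) valid by (intro card_chain_maps_links) auto
    also have "{i \<in> coloured v. m i = 0} = {i\<in>{1..n}. x i = (v, 0)}"
      by (auto simp: m_def prod_eq_iff)
    finally show ?thesis .
  qed
  \<comment> \<open>\<open>ht\<close> records the index of each value within its class, and
    \<open>pm\<close> rebuilds the value from class and index.\<close>
  define ht where "ht p = (\<lambda>v\<in>{..<s}. \<lambda>i\<in>coloured v. (p i - 1) div s)" for p :: "nat \<Rightarrow> nat"
  define pm where "pm \<phi> i = (if i \<in> {1..n} then 1 + fst (x i) + s * \<phi> (fst (x i)) i else i)"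
    for \<phi> :: "nat \<Rightarrow> nat \<Rightarrow> nat" and i
  have xs: "fst (x i) < s" if "i \<in> {1..n}" for i using x[OF that] by auto
  have ht_in: "ht p \<in> PiE {..<s} K" and pm_ht: "pm (ht p) = p" if p: "p \<in> lettered" for p
  proof -
    have perm: "p permutes {1..n}" using p by simp
    have pos: "p j \<in> {1..n}" if "j \<in> {1..n}" for j
      using permutes_in_image[OF perm] that by simp
    have col: "fst (x j) = (p j - 1) mod s" and link: "link r s p j (m j)" if "j \<in> {1..n}" for j
      using p that by (auto simp: m_def)
    have dec: "p i = 1 + v + s * ((p i - 1) div s)" if "i \<in> coloured v" for i v
    proof -
      have "p i - 1 = v + s * ((p i - 1) div s)" using col[of i] that by simp
      then show ?thesis using pos[of i] that by simp
    qed
    have "ht p v \<in> K v" if v: "v < s" for v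
    proof -
      have hv: "ht p v i = (p i - 1) div s" if "i \<in> coloured v" for i
        using that v by (simp add: ht_def)
      have "ht p v \<in> coloured v \<rightarrow>\<^sub>E {..<card (coloured v)}"
      proof (rule PiE_I)
        fix i assume i: "i \<in> coloured v"
        then have "p i \<le> n" using pos[of i] by simp
        then show "ht p v i \<in> {..<card (coloured v)}"
          using v dec[OF i] card[OF v] hv[OF i] by (simp add: less_class_size_iff)
      qed (use v in \<open>auto simp: ht_def\<close>)
      moreover have "inj_on (ht p v) (coloured v)"
      proof (rule inj_onI)
        fix i j assume ij: "i \<in> coloured v" "j \<in> coloured v" "ht p v i = ht p v j"
        then have "p i = p j" using dec[OF ij(1)] dec[OF ij(2)] by (simp add: hv)
        then show "i = j" using perm by (auto dest: permutes_inj injD)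
      qed
      moreover have "ht p v b = Suc (ht p v a)" if "(a, b) \<in> links r (coloured v) m" for a b
      proof -
        from that obtain i where i: "i \<in> coloured v" "m i \<noteq> 0"
          and ab: "a = i - r \<and> b = i \<and> m i = 1 \<or> a = i \<and> b = i - r \<and> m i = 2"
          by (auto simp: links_def)
        have j: "i - r \<in> coloured v" using valid[OF i] by simp
        have "link r s p i (m i)" using link i by simp
        with ab have "p b = p a + s" by (auto simp: link_def)
        moreover have "a \<in> coloured v" "b \<in> coloured v" using i j ab by auto
        ultimately have "s * ht p v b = s * ht p v a + s"
          using dec[of a v] dec[of b v] hv[of a] hv[of b] by simp
        then have "s * ht p v b = s * Suc (ht p v a)" by simp
        then show ?thesis using rs(2) by (simp only: mult_cancel1) simp
      qed
      ultimately show ?thesis unfolding K_def chain_maps_def by blast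
    qed
    then show "ht p \<in> PiE {..<s} K" by (auto simp: ht_def)
    show "pm (ht p) = p"
    proof
      fix i
      show "pm (ht p) i = p i"
      proof (cases "i \<in> {1..n}")
        case True
        then have "pm (ht p) i = 1 + fst (x i) + s * ((p i - 1) div s)"
          using xs[OF True] by (simp add: pm_def ht_def)
        also have "\<dots> = p i" using dec[of i "fst (x i)"] True by simp
        finally show ?thesis .
      next
        case False
        then show ?thesis using perm by (auto simp: pm_def permutes_def)
      qed
    qed
  qed
  have pm_in: "pm \<phi> \<in> lettered" and ht_pm: "ht (pm \<phi>) = \<phi>" if \<phi>: "\<phi> \<in> PiE {..<s} K" for \<phi>
  proof -
    have pm: "pm \<phi> i = 1 + v + s * \<phi> v i" if "i \<in> coloured v" for i v
      using that by (auto simp: pm_def)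
    have K: "\<phi> v \<in> K v" if "v < s" for v using \<phi> that by auto
    have bd: "\<phi> v i < class_size s n v" if "i \<in> coloured v" "v < s" for i v
      using K[OF that(2)] that card[OF that(2)] by (auto simp: K_def chain_maps_def)
    have inj: "inj_on (\<phi> v) (coloured v)" if "v < s" for v
      using K[OF that] by (auto simp: K_def chain_maps_def)
    have lk: "\<phi> v b = Suc (\<phi> v a)" if "v < s" "(a, b) \<in> links r (coloured v) m" for v a b
      using K[OF that(1)] that(2) by (auto simp: K_def chain_maps_def)
    have col: "(pm \<phi> i - 1) mod s = fst (x i)" "(pm \<phi> i - 1) div s = \<phi> (fst (x i)) i" if "i \<in> {1..n}" for i
      using pm[of i "fst (x i)"] xs[OF that] that by auto
    have "pm \<phi> permutes {1..n}"
    proof (rule inj_imp_permutes)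
      show "inj_on (pm \<phi>) {1..n}"
      proof (rule inj_onI)
        fix i j assume ij: "i \<in> {1..n}" "j \<in> {1..n}" "pm \<phi> i = pm \<phi> j"
        then have "fst (x i) = fst (x j)" "\<phi> (fst (x i)) i = \<phi> (fst (x j)) j"
          using col[of i] col[of j] by simp_all
        then show "i = j" using inj[OF xs[OF ij(1)]] ij by (auto dest: inj_onD)
      qed
      fix i assume i: "i \<in> {1..n}"
      show "pm \<phi> i \<in> {1..n}"
        using bd[of i "fst (x i)"] xs[OF i] i by (simp add: pm less_class_size_iff)
    qed (auto simp: pm_def)
    moreover have "link r s (pm \<phi>) i (snd (x i))" if i: "i \<in> {1..n}" for i
    proof (cases "m i = 0")
      case False
      let ?v = "fst (x i)"
      have iv: "i \<in> coloured ?v" using i by simp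
      note va = valid[OF iv False]
      then have jv: "i - r \<in> coloured ?v" by simp
      have "m i = 1 \<and> \<phi> ?v i = Suc (\<phi> ?v (i - r)) \<or> m i = 2 \<and> \<phi> ?v (i - r) = Suc (\<phi> ?v i)"
        using va iv lk[OF xs[OF i]] by (auto simp: links_def)
      then show ?thesis using pm[OF iv] pm[OF jv] va by (auto simp: link_def m_def)
    qed (simp add: link_def m_def)
    ultimately show "pm \<phi> \<in> lettered" using col by simp
    show "ht (pm \<phi>) = \<phi>"
    proof
      fix v
      show "ht (pm \<phi>) v = \<phi> v"
      proof (cases "v < s")
        case True
        then have "\<phi> v \<in> extensional (coloured v)" using K by (auto simp: K_def chain_maps_def PiE_iff)
        then show ?thesis using True col by (auto simp: ht_def extensional_def fun_eq_iff)
      next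
        case False
        then show ?thesis using \<phi> by (auto simp: ht_def PiE_iff extensional_def)
      qed
    qed
  qed
  have "bij_betw ht lettered (PiE {..<s} K)"
    by (rule bij_betw_byWitness[where f' = pm]) (use ht_in pm_ht pm_in ht_pm in blast)+
  from bij_betw_same_card[OF this] show ?thesis
    by (simp add: card_PiE cardK)
qed

text \<open>For admissible letters the local weights are the signs and the factorials count the
  permutations; otherwise both sides vanish.\<close>

lemma card_lettered:
  "(\<Prod>i\<in>{1..n}. if snd (x i) = 0 then 1 else - 1) * of_nat (card lettered) =
   (\<Prod>i\<in>{1..n}. lwt r x i) * (\<Prod>v<s. if card (coloured v) = class_size s n v
      then fact (card {i\<in>{1..n}. x i = (v, 0)}) else 0)"
proof (cases "(\<forall>i\<in>{1..n}. lwt r x i \<noteq> 0) \<and> (\<forall>v<s. card (coloured v) = class_size s n v)")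
  case True
  then have "(\<Prod>i\<in>{1..n}. if snd (x i) = 0 then 1 else - 1) = (\<Prod>i\<in>{1..n}. lwt r x i)"
  proof (intro prod.cong refl)
    fix i assume "i \<in> {1..n}"
    with True have "lwt r x i \<noteq> 0" by blast
    then show "(if snd (x i) = 0 then 1 else - 1) = lwt r x i" by (auto simp: lwt_def split: if_splits)
  qed
  moreover from True have "card lettered = (\<Prod>v<s. fact (card {i\<in>{1..n}. x i = (v, 0)}))"
    by (intro card_lettered_valid) auto
  ultimately show ?thesis using True by simp
next
  case False
  then have "lettered = {}" using lettered_lwt_nonzero lettered_card_coloured by blast
  then have "card lettered = 0" by (simp only: card.empty)
  moreover from False have "(\<Prod>i\<in>{1..n}. lwt r x i) = 0 \<or>
      (\<Prod>v<s. if card (coloured v) = class_size s n v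
        then fact (card {i\<in>{1..n}. x i = (v, 0)}) else 0 :: rat) = 0"
    by auto
  ultimately show ?thesis by auto
qed

end

text \<open>Inclusion-exclusion for a fixed permutation. The sum factorises over positions, where
  the residue is forced and only the mode remains free.\<close>

lemma good_eq_sum_letters:
  assumes s: "s \<ge> 1" and e: "e \<le> 1"
  shows "(\<Sum>x\<in>{1..n} \<rightarrow>\<^sub>E letters s e. (\<Prod>i\<in>{1..n}. if snd (x i) = 0 then 1 else - 1) *
      of_bool (\<forall>i\<in>{1..n}. fst (x i) = (p i - 1) mod s \<and> link r s p i (snd (x i)))) =
    (of_bool (good e r s n p) :: rat)" (is "?lhs = _")
proof -
  let ?t = "\<lambda>i l. of_bool (fst l = (p i - 1) mod s) * ((if snd l = 0 then 1 else - 1) * of_bool (link r s p i (snd l))) :: rat"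
  let ?bad = "\<lambda>i. r < i \<and> (p i = p (i - r) + s \<or> e = 1 \<and> p (i - r) = p i + s)"
  have "?lhs = (\<Sum>x\<in>{1..n} \<rightarrow>\<^sub>E letters s e. \<Prod>i\<in>{1..n}. ?t i (x i))"
  proof (intro sum.cong refl)
    fix x
    have "of_bool (\<forall>i\<in>{1..n}. fst (x i) = (p i - 1) mod s \<and> link r s p i (snd (x i))) =
        (\<Prod>i\<in>{1..n}. of_bool (fst (x i) = (p i - 1) mod s \<and> link r s p i (snd (x i))) :: rat)"
      by (cases "\<forall>i\<in>{1..n}. fst (x i) = (p i - 1) mod s \<and> link r s p i (snd (x i))") auto
    then show "(\<Prod>i\<in>{1..n}. if snd (x i) = 0 then 1 else - 1) *
      of_bool (\<forall>i\<in>{1..n}. fst (x i) = (p i - 1) mod s \<and> link r s p i (snd (x i))) =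
      (\<Prod>i\<in>{1..n}. ?t i (x i))"
      by (simp only: prod.distrib[symmetric]) (intro prod.cong refl, auto)
  qed
  also have "\<dots> = (\<Prod>i\<in>{1..n}. \<Sum>l\<in>letters s e. ?t i l)"
    by (rule prod_sum_PiE[symmetric]) auto
  also have "\<dots> = (\<Prod>i\<in>{1..n}. of_bool (\<not> ?bad i))"
  proof (intro prod.cong refl)
    fix i
    have "(\<Sum>l\<in>letters s e. ?t i l) = (\<Sum>v<s. of_bool (v = (p i - 1) mod s)) *
        (\<Sum>m\<le>Suc e. (if m = 0 then 1 else - 1) * of_bool (link r s p i m))"
      by (simp only: sum_product sum.cartesian_product case_prod_unfold)
    also have "(\<Sum>v<s. of_bool (v = (p i - 1) mod s)) = (1 :: rat)"
      using s by (simp add: of_bool_def)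
    \<comment> \<open>Mode 0 contributes 1 and each forbidden relation that holds contributes -1.
      Ascent and descent by \<open>s\<close> exclude each other because \<open>s\<close> is
      positive, so the total is 0 or 1.\<close>
    also have "(\<Sum>m\<le>Suc e. (if m = 0 then 1 else - 1) * of_bool (link r s p i m)) = (of_bool (\<not> ?bad i) :: rat)"
    proof -
      have "e = 0 \<or> e = 1" using e by auto
      then show ?thesis using s by (auto simp: link_def numeral_2_eq_2)
    qed
    finally show "(\<Sum>l\<in>letters s e. ?t i l) = of_bool (\<not> ?bad i)" by simp
  qed
  also have "\<dots> = of_bool (\<forall>i\<in>{1..n}. \<not> ?bad i)"
    by (cases "\<forall>i\<in>{1..n}. \<not> ?bad i") auto
  also have "(\<forall>i\<in>{1..n}. \<not> ?bad i) \<longleftrightarrow> good e r s n p"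
  proof
    assume *: "\<forall>i\<in>{1..n}. \<not> ?bad i"
    show "good e r s n p"
      unfolding good_def
    proof (intro allI impI)
      fix i assume "1 \<le> i \<and> i + r \<le> n"
      with *[rule_format, of "i + r"]
      show "p (i + r) \<noteq> p i + s \<and> (e = 1 \<longrightarrow> p i \<noteq> p (i + r) + s)" by auto
    qed
  next
    assume *: "good e r s n p"
    show "\<forall>i\<in>{1..n}. \<not> ?bad i"
    proof
      fix i assume i: "i \<in> {1..n}"
      show "\<not> ?bad i"
      proof
        assume bad: "?bad i"
        then have "1 \<le> i - r \<and> i - r + r \<le> n" using i by auto
        from *[unfolded good_def, rule_format, OF this] bad show False by auto
      qed
    qed
  qed
  finally show ?thesis .
qed

lemma card_good_eq_sum_letters:
  assumes "r \<ge> 1" "s \<ge> 1" "e \<le> 1"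
  shows "of_nat (card {p. p permutes {1..n} \<and> good e r s n p}) =
    (\<Sum>x\<in>{1..n} \<rightarrow>\<^sub>E letters s e. (\<Prod>i\<in>{1..n}. lwt r x i) *
      (\<Prod>v<s. if card {i\<in>{1..n}. fst (x i) = v} = class_size s n v
        then fact (card {i\<in>{1..n}. x i = (v, 0)}) else 0))"
proof -
  let ?P = "{p. p permutes {1..n}}"
  let ?sg = "\<lambda>x. \<Prod>i\<in>{1..n}. if snd (x i) = (0::nat) then 1 else - 1 :: rat"
  let ?ok = "\<lambda>x p. \<forall>i\<in>{1..n}. fst (x i) = (p i - 1) mod s \<and> link r s p i (snd (x i))"
  have fin: "finite ?P" by (rule finite_permutations) simp
  have "of_nat (card {p. p permutes {1..n} \<and> good e r s n p}) = (\<Sum>p\<in>?P. of_bool (good e r s n p) :: rat)"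
    using fin by (simp add: of_bool_def sum.If_cases Int_def)
  also have "\<dots> = (\<Sum>p\<in>?P. \<Sum>x\<in>{1..n} \<rightarrow>\<^sub>E letters s e. ?sg x * of_bool (?ok x p))"
    by (simp only: good_eq_sum_letters[OF assms(2,3)])
  also have "\<dots> = (\<Sum>x\<in>{1..n} \<rightarrow>\<^sub>E letters s e. \<Sum>p\<in>?P. ?sg x * of_bool (?ok x p))"
    by (rule sum.swap)
  also have "\<dots> = (\<Sum>x\<in>{1..n} \<rightarrow>\<^sub>E letters s e. ?sg x * of_nat (card {p. p permutes {1..n} \<and> ?ok x p}))"
    using fin by (simp add: of_bool_def sum.If_cases Int_def flip: sum_distrib_left)
  also have "\<dots> = (\<Sum>x\<in>{1..n} \<rightarrow>\<^sub>E letters s e. (\<Prod>i\<in>{1..n}. lwt r x i) *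
      (\<Prod>v<s. if card {i\<in>{1..n}. fst (x i) = v} = class_size s n v
        then fact (card {i\<in>{1..n}. x i = (v, 0)}) else 0))"
  proof (intro sum.cong refl card_lettered[OF assms])
    fix x i assume "x \<in> {1..n} \<rightarrow>\<^sub>E letters s e" "i \<in> {1..n}"
    then show "x i \<in> letters s e" by (rule PiE_mem)
  qed
  finally show ?thesis .
qed

section \<open>Words on a single path\<close>

text \<open>Signed generating function of one block by length: coefficient 1 at length 1 and
  \<open>(1 + e) * (- 1) ^ (l - 1)\<close> at length \<open>l\<close> from 2 on, since a longer
  block has \<open>1 + e\<close> possible directions.\<close>

definition block_fps :: "nat \<Rightarrow> rat fps" where
  "block_fps e = fps_X * (1 - of_nat e * fps_X) * inverse (1 + fps_X)"

definition block_coeff :: "nat \<Rightarrow> int \<Rightarrow> int \<Rightarrow> rat" where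
  "block_coeff e l k = (if l < 0 \<or> k < 0 then 0 else fps_nth (block_fps e ^ nat k) (nat l))"

lemma block_fps_mult: "block_fps e * (1 + fps_X) = fps_X * (1 - of_nat e * fps_X)"
proof -
  have "inverse (1 + fps_X) * (1 + fps_X) = (1 :: rat fps)"
    by (rule inverse_mult_eq_1) simp
  then show ?thesis by (simp add: block_fps_def mult.assoc)
qed

text \<open>Coefficient comparison in \<open>block_fps_mult\<close> after multiplication by the
  power \<open>k - 1\<close> of the series.\<close>

lemma block_coeff_rec:
  assumes "k \<ge> 1"
  shows "block_coeff e l k + block_coeff e (l - 1) k =
    block_coeff e (l - 1) (k - 1) - of_nat e * block_coeff e (l - 2) (k - 1)"
proof -
  define k' where "k' = nat (k - 1)"
  have k: "k = int (Suc k')" using assms by (simp add: k'_def)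
  have eq: "block_fps e ^ Suc k' + fps_X * block_fps e ^ Suc k' =
      fps_X * block_fps e ^ k' - of_nat e * (fps_X * (fps_X * block_fps e ^ k'))"
  proof -
    have "block_fps e ^ Suc k' * (1 + fps_X) = block_fps e ^ k' * (block_fps e * (1 + fps_X))"
      by (simp add: mult_ac)
    also have "\<dots> = block_fps e ^ k' * (fps_X * (1 - of_nat e * fps_X))"
      by (simp only: block_fps_mult)
    finally show ?thesis by (simp add: algebra_simps)
  qed
  have nth: "fps_nth (block_fps e ^ Suc k') j + (if j = 0 then 0 else fps_nth (block_fps e ^ Suc k') (j - 1)) =
      (if j = 0 then 0 else fps_nth (block_fps e ^ k') (j - 1)) -
      of_nat e * (if j \<le> 1 then 0 else fps_nth (block_fps e ^ k') (j - 2))" for j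
    using arg_cong[OF eq, of "\<lambda>f. fps_nth f j"]
    by (cases j) (auto simp: fps_of_nat[symmetric] numeral_2_eq_2 Suc_le_eq simp del: power_Suc fps_of_nat split: if_splits nat.splits)
  have bc: "block_coeff e (int i) k = fps_nth (block_fps e ^ Suc k') i"
    "block_coeff e (int i) (k - 1) = fps_nth (block_fps e ^ k') i" for i
    unfolding block_coeff_def k by (simp_all add: nat_add_distrib)
  consider "l < 0" | "l = 0" | "l = 1" | "l \<ge> 2" by linarith
  then show ?thesis
  proof cases
    case 4
    define j where "j = nat l"
    have "l = int j" "l - 1 = int (j - 1)" "l - 2 = int (j - 2)" "2 \<le> j" using 4 by (auto simp: j_def)
    then show ?thesis using nth[of j] by (simp only: bc) simp
  qed (use nth[of 0] nth[of 1] bc[of 0] bc[of 1] in \<open>simp_all add: block_coeff_def\<close>)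
qed

lemma block_coeff_0: "block_coeff e l 0 = zdelta l"
  by (auto simp: block_coeff_def zdelta_def)

lemma block_coeff_0_left: "block_coeff e 0 k = zdelta k"
  by (auto simp: block_coeff_def zdelta_def block_fps_def fps_nth_power_0)

text \<open>List version of \<open>lwt\<close> along one path. Words are stored backwards, so the
  head of \<open>w\<close> is the letter \<open>r\<close> positions earlier.\<close>

fun word_wt :: "(nat \<times> nat) list \<Rightarrow> rat" where
  "word_wt [] = 1"
| "word_wt ((v, m) # w) = (if m = 0 then 1
     else if w \<noteq> [] \<and> fst (hd w) = v \<and> snd (hd w) \<in> {0, m} then - 1 else 0) * word_wt w"

definition words :: "nat \<Rightarrow> nat \<Rightarrow> nat \<Rightarrow> (nat \<times> nat) list set" where
  "words s e L = {w. set w \<subseteq> letters s e \<and> length w = L}"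

text \<open>Each block has exactly one letter of mode 0, so this counts the blocks labelled
  \<open>v\<close>.\<close>

definition nstarts :: "(nat \<times> nat) list \<Rightarrow> nat \<Rightarrow> nat" where
  "nstarts w v = length (filter (\<lambda>l. l = (v, 0)) w)"

definition nlabel :: "(nat \<times> nat) list \<Rightarrow> nat \<Rightarrow> nat" where
  "nlabel w v = length (filter (\<lambda>l. fst l = v) w)"

lemma finite_words [simp]: "finite (words s e L)"
  unfolding words_def by (rule finite_lists_length_eq) simp

lemma words_0: "words s e 0 = {[]}"
  by (auto simp: words_def)

lemma sum_words_Suc:
  "(\<Sum>w\<in>words s e (Suc L). f w) = (\<Sum>v<s. \<Sum>m\<le>Suc e. \<Sum>w\<in>words s e L. f ((v, m) # w))"
proof -
  have "(\<Sum>w\<in>words s e (Suc L). f w) = (\<Sum>(l, w)\<in>letters s e \<times> words s e L. f (l # w))"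
    by (rule sum.reindex_bij_witness[of _ "\<lambda>(l, w). l # w" "\<lambda>w. (hd w, tl w)"])
      (auto simp: words_def length_Suc_conv)
  also have "\<dots> = (\<Sum>l\<in>letters s e. \<Sum>w\<in>words s e L. f (l # w))"
    by (rule sum.cartesian_product[symmetric])
  also have "\<dots> = (\<Sum>v<s. \<Sum>m\<le>Suc e. \<Sum>w\<in>words s e L. f ((v, m) # w))"
    unfolding sum.cartesian_product[of "\<lambda>v m. \<Sum>w\<in>words s e L. f ((v, m) # w)"]
    by (simp only: case_prod_unfold prod.collapse)
  finally show ?thesis .
qed

context
  fixes s e :: nat
begin

definition stats :: "(nat \<Rightarrow> int) \<Rightarrow> (nat \<Rightarrow> int) \<Rightarrow> (nat \<times> nat) list \<Rightarrow> bool" where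
  "stats \<kappa> \<mu> w \<longleftrightarrow> (\<forall>v<s. int (nstarts w v) = \<kappa> v \<and> int (nlabel w v) = \<mu> v)"

text \<open>Statistics are integer-valued so that lowering one of them needs no case distinction at
  zero.\<close>

definition dec :: "nat \<Rightarrow> (nat \<Rightarrow> int) \<Rightarrow> nat \<Rightarrow> int" where
  "dec v \<kappa> u = (if u = v then \<kappa> v - 1 else \<kappa> u)"

definition word_sum :: "nat \<Rightarrow> (nat \<Rightarrow> int) \<Rightarrow> (nat \<Rightarrow> int) \<Rightarrow> rat" where
  "word_sum L \<kappa> \<mu> = (\<Sum>w\<in>words s e L. of_bool (stats \<kappa> \<mu> w) * word_wt w)"

definition head_sum :: "nat \<Rightarrow> nat \<Rightarrow> nat \<Rightarrow> (nat \<Rightarrow> int) \<Rightarrow> (nat \<Rightarrow> int) \<Rightarrow> rat" where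
  "head_sum v m L \<kappa> \<mu> =
    (\<Sum>w\<in>words s e L. of_bool (stats \<kappa> \<mu> w) * of_bool (w \<noteq> [] \<and> hd w = (v, m)) * word_wt w)"

section \<open>Recurrences for word sums refined by the first letter\<close>

lemma stats_Cons:
  assumes "v < s"
  shows "stats \<kappa> \<mu> ((v, m) # w) \<longleftrightarrow> stats (if m = 0 then dec v \<kappa> else \<kappa>) (dec v \<mu>) w"
  unfolding stats_def nstarts_def nlabel_def dec_def using assms
  by (intro all_cong) auto

lemma head_sum_Suc:
  assumes "v < s" "m \<le> Suc e"
  shows "head_sum v m (Suc L) \<kappa> \<mu> =
    (\<Sum>w\<in>words s e L. of_bool (stats \<kappa> \<mu> ((v, m) # w)) * word_wt ((v, m) # w))"
proof -
  have "head_sum v m (Suc L) \<kappa> \<mu> = (\<Sum>v'<s. \<Sum>m'\<le>Suc e. if v' = v \<and> m' = m then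
    (\<Sum>w\<in>words s e L. of_bool (stats \<kappa> \<mu> ((v, m) # w)) * word_wt ((v, m) # w)) else 0)"
    unfolding head_sum_def sum_words_Suc by (intro sum.cong refl) auto
  also have "\<dots> = (\<Sum>v'<s. if v' = v then
    (\<Sum>w\<in>words s e L. of_bool (stats \<kappa> \<mu> ((v, m) # w)) * word_wt ((v, m) # w)) else 0)"
    using assms(2) by (intro sum.cong refl) (auto simp del: sum.atMost_Suc)
  also have "\<dots> = (\<Sum>w\<in>words s e L. of_bool (stats \<kappa> \<mu> ((v, m) # w)) * word_wt ((v, m) # w))"
    using assms(1) by simp
  finally show ?thesis .
qed

lemma head_sum_0: "head_sum v m 0 \<kappa> \<mu> = 0"
  by (simp add: head_sum_def words_0)

lemma head_sum_start:
  assumes "v < s"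
  shows "head_sum v 0 (Suc L) \<kappa> \<mu> = word_sum L (dec v \<kappa>) (dec v \<mu>)"
  by (simp add: head_sum_Suc assms stats_Cons word_sum_def)

text \<open>A letter of mode \<open>m > 0\<close> continues a block: the letter below it has the
  same label and is a start or has mode \<open>m\<close> again. It contributes a sign but no new
  block.\<close>

lemma head_sum_cont:
  assumes "v < s" "0 < m" "m \<le> Suc e"
  shows "head_sum v m (Suc L) \<kappa> \<mu> =
    - (head_sum v 0 L \<kappa> (dec v \<mu>) + head_sum v m L \<kappa> (dec v \<mu>))"
proof -
  have "of_bool (stats \<kappa> \<mu> ((v, m) # w)) * word_wt ((v, m) # w) =
     - (of_bool (stats \<kappa> (dec v \<mu>) w) * of_bool (w \<noteq> [] \<and> hd w = (v, 0)) * word_wt w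
      + of_bool (stats \<kappa> (dec v \<mu>) w) * of_bool (w \<noteq> [] \<and> hd w = (v, m)) * word_wt w)" for w
    using assms by (auto simp: stats_Cons prod_eq_iff)
  then show ?thesis
    unfolding head_sum_Suc[OF assms(1,3)] unfolding head_sum_def
    by (simp only: sum_negf sum.distrib)
qed

definition label_sum :: "nat \<Rightarrow> nat \<Rightarrow> (nat \<Rightarrow> int) \<Rightarrow> (nat \<Rightarrow> int) \<Rightarrow> rat" where
  "label_sum v L \<kappa> \<mu> = (\<Sum>m\<le>Suc e. head_sum v m L \<kappa> \<mu>)"

lemma word_sum_Suc: "word_sum (Suc L) \<kappa> \<mu> = (\<Sum>v<s. label_sum v (Suc L) \<kappa> \<mu>)"
  unfolding label_sum_def word_sum_def sum_words_Suc
  by (intro sum.cong refl) (simp add: head_sum_Suc del: sum.atMost_Suc)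

text \<open>Summing \<open>head_sum_cont\<close> over the \<open>e + 1\<close> nonzero modes counts
  a start in second place \<open>e + 1\<close> times, whereas \<open>label_sum\<close> accounts for
  it once; the term with factor \<open>e\<close> is the excess.\<close>

lemma label_sum_rec:
  assumes "v < s"
  shows "label_sum v (Suc L) \<kappa> \<mu> + label_sum v L \<kappa> (dec v \<mu>) =
    head_sum v 0 (Suc L) \<kappa> \<mu> - of_nat e * head_sum v 0 L \<kappa> (dec v \<mu>)"
proof -
  have split: "label_sum v L \<kappa> \<mu> = head_sum v 0 L \<kappa> \<mu> + (\<Sum>m\<le>e. head_sum v (Suc m) L \<kappa> \<mu>)" for L \<mu>
    unfolding label_sum_def by (rule sum.atMost_Suc_shift)
  have "(\<Sum>m\<le>e. head_sum v (Suc m) (Suc L) \<kappa> \<mu>) =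
      (\<Sum>m\<le>e. - (head_sum v 0 L \<kappa> (dec v \<mu>) + head_sum v (Suc m) L \<kappa> (dec v \<mu>)))"
    using assms by (intro sum.cong refl head_sum_cont) auto
  also have "\<dots> = - of_nat (Suc e) * head_sum v 0 L \<kappa> (dec v \<mu>) - (\<Sum>m\<le>e. head_sum v (Suc m) L \<kappa> (dec v \<mu>))"
    by (simp add: sum_negf sum.distrib sum_subtractf algebra_simps)
  finally show ?thesis unfolding split by (simp add: algebra_simps)
qed

section \<open>Closed form of the word sums\<close>

definition multinom :: "(nat \<Rightarrow> int) \<Rightarrow> rat" where
  "multinom \<kappa> = zfact (\<Sum>v<s. \<kappa> v) * (\<Prod>v<s. zinvfact (\<kappa> v))"

text \<open>The multinomial coefficient chooses the order of the block labels, and the block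
  coefficients count the signed ways to distribute the lengths.\<close>

definition closed_word :: "int \<Rightarrow> (nat \<Rightarrow> int) \<Rightarrow> (nat \<Rightarrow> int) \<Rightarrow> rat" where
  "closed_word L \<kappa> \<mu> =
    (if (\<Sum>v<s. \<mu> v) = L then multinom \<kappa> * (\<Prod>v<s. block_coeff e (\<mu> v) (\<kappa> v)) else 0)"

text \<open>The block at the head has label \<open>v\<close>, so only the remaining blocks are
  ordered freely, while all block lengths still vary.\<close>

definition closed_label :: "nat \<Rightarrow> int \<Rightarrow> (nat \<Rightarrow> int) \<Rightarrow> (nat \<Rightarrow> int) \<Rightarrow> rat" where
  "closed_label v L \<kappa> \<mu> =
    (if (\<Sum>v<s. \<mu> v) = L then multinom (dec v \<kappa>) * (\<Prod>v<s. block_coeff e (\<mu> v) (\<kappa> v)) else 0)"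

lemma zinvfact_dec: "zinvfact (k - 1) = of_int k * zinvfact k"
proof (cases "k \<ge> 1")
  case True
  define j where "j = nat (k - 1)"
  have "k = int (Suc j)" using True by (simp add: j_def)
  then have "nat k = Suc j" "nat (k - 1) = j" "of_int k = (of_nat (Suc j) :: rat)" by simp_all
  then show ?thesis using True by (simp add: zinvfact_def field_simps del: of_nat_Suc)
qed (auto simp: zinvfact_def)

lemma zfact_rec: "k \<ge> 1 \<Longrightarrow> zfact k = of_int k * zfact (k - 1)"
  by (simp add: zfact_def nat_diff_distrib fact_reduce[of "nat k"] of_nat_nat)

lemma sum_dec:
  assumes "v < s"
  shows "(\<Sum>u<s. dec v \<mu> u) = (\<Sum>u<s. \<mu> u) - 1"
proof -
  have "(\<Sum>u<s. dec v \<mu> u) = (\<Sum>u<s. \<mu> u - (if u = v then 1 else 0))"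
    by (intro sum.cong) (auto simp: dec_def)
  then show ?thesis using assms by (simp add: sum_subtractf)
qed

lemma multinom_dec:
  assumes "v < s"
  shows "multinom (dec v \<kappa>) = of_int (\<kappa> v) * zfact ((\<Sum>u<s. \<kappa> u) - 1) * (\<Prod>u<s. zinvfact (\<kappa> u))"
proof -
  have "(\<Prod>u<s. zinvfact (dec v \<kappa> u)) = zinvfact (\<kappa> v - 1) * (\<Prod>u\<in>{..<s} - {v}. zinvfact (\<kappa> u))"
    using assms by (subst prod.remove[of _ v]) (auto simp: dec_def)
  also have "\<dots> = of_int (\<kappa> v) * (\<Prod>u<s. zinvfact (\<kappa> u))"
    using assms by (subst prod.remove[of "{..<s}" v]) (auto simp: zinvfact_dec)
  finally show ?thesis by (simp add: multinom_def sum_dec[OF assms])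
qed

text \<open>All four terms share \<open>multinom (dec v \<kappa>)\<close> and the factors of labels
  other than \<open>v\<close>; what remains is \<open>block_coeff_rec\<close> for label
  \<open>v\<close>. If \<open>\<kappa> v < 1\<close> or the lengths have the wrong sum, every term
  is zero.\<close>

lemma closed_label_rec:
  assumes v: "v < s"
  shows "closed_label v (L + 1) \<kappa> \<mu> + closed_label v L \<kappa> (dec v \<mu>) =
    closed_word L (dec v \<kappa>) (dec v \<mu>) - of_nat e * closed_word (L - 1) (dec v \<kappa>) (dec v (dec v \<mu>))"
proof (cases "\<kappa> v \<ge> 1 \<and> (\<Sum>u<s. \<mu> u) = L + 1")
  case True
  let ?P = "\<Prod>u\<in>{..<s} - {v}. block_coeff e (\<mu> u) (\<kappa> u)"
  have P: "(\<Prod>u<s. block_coeff e (\<mu>' u) (\<kappa>' u)) = block_coeff e (\<mu>' v) (\<kappa>' v) * ?P"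
    if "\<And>u. u \<noteq> v \<Longrightarrow> \<mu>' u = \<mu> u \<and> \<kappa>' u = \<kappa> u" for \<mu>' \<kappa>'
  proof -
    have "(\<Prod>u<s. block_coeff e (\<mu>' u) (\<kappa>' u)) = block_coeff e (\<mu>' v) (\<kappa>' v) *
        (\<Prod>u\<in>{..<s} - {v}. block_coeff e (\<mu>' u) (\<kappa>' u))"
      using v by (intro prod.remove) auto
    also have "(\<Prod>u\<in>{..<s} - {v}. block_coeff e (\<mu>' u) (\<kappa>' u)) = ?P"
      using that by (intro prod.cong) auto
    finally show ?thesis .
  qed
  have Ps: "(\<Prod>u<s. block_coeff e (\<mu> u) (\<kappa> u)) = block_coeff e (\<mu> v) (\<kappa> v) * ?P"
    "(\<Prod>u<s. block_coeff e (dec v \<mu> u) (\<kappa> u)) = block_coeff e (\<mu> v - 1) (\<kappa> v) * ?P"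
    "(\<Prod>u<s. block_coeff e (dec v \<mu> u) (dec v \<kappa> u)) = block_coeff e (\<mu> v - 1) (\<kappa> v - 1) * ?P"
    "(\<Prod>u<s. block_coeff e (dec v (dec v \<mu>) u) (dec v \<kappa> u)) = block_coeff e (\<mu> v - 2) (\<kappa> v - 1) * ?P"
    using P[of \<mu> \<kappa>] P[of "dec v \<mu>" \<kappa>] P[of "dec v \<mu>" "dec v \<kappa>"] P[of "dec v (dec v \<mu>)" "dec v \<kappa>"]
    by (simp_all add: dec_def)
  have "(\<Sum>u<s. \<mu> u) = L + 1" "(\<Sum>u<s. dec v \<mu> u) = L" "(\<Sum>u<s. dec v (dec v \<mu>) u) = L - 1"
    using True by (simp_all only: sum_dec[OF v])
  then have *: "closed_label v (L + 1) \<kappa> \<mu> = multinom (dec v \<kappa>) * ?P * block_coeff e (\<mu> v) (\<kappa> v)"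
    "closed_label v L \<kappa> (dec v \<mu>) = multinom (dec v \<kappa>) * ?P * block_coeff e (\<mu> v - 1) (\<kappa> v)"
    "closed_word L (dec v \<kappa>) (dec v \<mu>) = multinom (dec v \<kappa>) * ?P * block_coeff e (\<mu> v - 1) (\<kappa> v - 1)"
    "closed_word (L - 1) (dec v \<kappa>) (dec v (dec v \<mu>)) =
      multinom (dec v \<kappa>) * ?P * block_coeff e (\<mu> v - 2) (\<kappa> v - 1)"
    unfolding closed_label_def closed_word_def by (simp_all add: Ps mult_ac)
  show ?thesis
    unfolding * using block_coeff_rec[of "\<kappa> v" e "\<mu> v"] True
    by (simp only: distrib_left[symmetric]) (simp add: algebra_simps)
next
  case False
  have "multinom (dec v \<kappa>) = 0" if "\<not> \<kappa> v \<ge> 1"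
    using v that by (force simp: multinom_def zinvfact_def dec_def)
  moreover have "(\<Sum>u<s. dec v \<mu> u) = (\<Sum>u<s. \<mu> u) - 1" "(\<Sum>u<s. dec v (dec v \<mu>) u) = (\<Sum>u<s. \<mu> u) - 2"
    by (simp_all only: sum_dec[OF v])
  ultimately show ?thesis
    using False unfolding closed_label_def closed_word_def by auto
qed

text \<open>Pascal's identity for multinomial coefficients: the block at the head has some
  label.\<close>

lemma closed_word_eq_sum_label:
  assumes "L \<ge> 1"
  shows "closed_word L \<kappa> \<mu> = (\<Sum>v<s. closed_label v L \<kappa> \<mu>)"
proof (cases "(\<Sum>v<s. \<mu> v) = L")
  case True
  let ?S = "\<Sum>v<s. \<kappa> v"
  have "(\<Sum>v<s. multinom (dec v \<kappa>)) = of_int ?S * zfact (?S - 1) * (\<Prod>u<s. zinvfact (\<kappa> u))"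
    by (simp add: multinom_dec sum_distrib_right)
  moreover have "multinom \<kappa> * (\<Prod>v<s. block_coeff e (\<mu> v) (\<kappa> v)) =
      of_int ?S * zfact (?S - 1) * (\<Prod>u<s. zinvfact (\<kappa> u)) * (\<Prod>v<s. block_coeff e (\<mu> v) (\<kappa> v))"
  proof -
    consider "?S \<ge> 1" | v where "v < s" "\<kappa> v < 0" | "\<forall>v<s. \<kappa> v = 0"
    proof -
      have "?S \<ge> 1" if "\<forall>v<s. \<kappa> v \<ge> 0" "\<exists>v<s. \<kappa> v \<noteq> 0"
      proof -
        have "?S \<noteq> 0" using that by (subst sum_nonneg_eq_0_iff) auto
        moreover have "?S \<ge> 0" using that by (intro sum_nonneg) auto
        ultimately show ?thesis by linarith
      qed
      then show thesis using that by (meson not_le)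
    qed
    then show ?thesis
    proof cases
      case 1
      then show ?thesis by (simp add: multinom_def zfact_rec)
    next
      case 2
      then have "(\<Prod>u<s. zinvfact (\<kappa> u)) = 0" by (force simp: zinvfact_def)
      then show ?thesis by (simp add: multinom_def)
    next
      \<comment> \<open>With no blocks Pascal's identity would read 1 = 0. Positive length saves the
        claim: some \<open>\<mu> v\<close> is nonzero, and no blocks cannot cover it.\<close>
      case 3
      obtain v where "v < s" "\<mu> v \<noteq> 0"
        using True assms by (metis lessThan_iff not_one_le_zero sum.neutral)
      then have "(\<Prod>v<s. block_coeff e (\<mu> v) (\<kappa> v)) = 0"
        using 3 by (auto simp: block_coeff_0 zdelta_def)
      then show ?thesis by simp
    qed
  qed
  ultimately show ?thesis
    using True by (simp add: closed_word_def closed_label_def sum_distrib_right[symmetric])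
next
  case False
  then show ?thesis by (simp add: closed_word_def closed_label_def)
qed

lemma prod_block_coeff_sum_le_0:
  assumes "(\<Sum>v<s. \<mu> v) \<le> 0" "\<exists>v<s. \<mu> v \<noteq> 0"
  shows "(\<Prod>v<s. block_coeff e (\<mu> v) (\<kappa> v)) = 0"
proof -
  have "\<exists>v<s. \<mu> v < 0"
  proof (rule ccontr)
    assume "\<not> ?thesis"
    then have nn: "\<And>v. v < s \<Longrightarrow> \<mu> v \<ge> 0" by auto
    from assms(2) obtain v where "v < s" "\<mu> v \<noteq> 0" by blast
    with nn have "(\<Sum>v<s. \<mu> v) > 0" by (intro sum_pos2[of _ v]) (auto simp: order.strict_iff_order)
    with assms(1) show False by simp
  qed
  then show ?thesis by (force simp: block_coeff_def)
qed

lemma closed_word_neg: "L < 0 \<Longrightarrow> closed_word L \<kappa> \<mu> = 0"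
proof -
  assume "L < 0"
  show ?thesis
  proof (cases "(\<Sum>v<s. \<mu> v) = L")
    case True
    with \<open>L < 0\<close> have "\<exists>v<s. \<mu> v \<noteq> 0" by (metis lessThan_iff less_irrefl sum.neutral)
    with True \<open>L < 0\<close> show ?thesis by (simp add: closed_word_def prod_block_coeff_sum_le_0)
  qed (simp add: closed_word_def)
qed

lemma closed_label_0:
  assumes "v < s"
  shows "closed_label v 0 \<kappa> \<mu> = 0"
proof (cases "(\<Sum>v<s. \<mu> v) = 0 \<and> (\<forall>v<s. \<mu> v = 0)")
  case True
  show ?thesis
  proof (cases "\<kappa> v = 0")
    case k: True
    have "multinom (dec v \<kappa>) = 0" using assms k by (simp add: multinom_dec)
    then show ?thesis by (simp add: closed_label_def)
  next
    case False
    then have "(\<Prod>v<s. block_coeff e (\<mu> v) (\<kappa> v)) = 0"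
      using True assms by (auto simp: block_coeff_0_left zdelta_def)
    then show ?thesis by (simp add: closed_label_def)
  qed
next
  case False
  then show ?thesis using prod_block_coeff_sum_le_0[of \<mu> \<kappa>] by (auto simp: closed_label_def)
qed

lemma word_sum_0: "word_sum 0 \<kappa> \<mu> = closed_word 0 \<kappa> \<mu>"
proof -
  have "word_sum 0 \<kappa> \<mu> = of_bool (\<forall>v<s. \<kappa> v = 0 \<and> \<mu> v = 0)"
    by (auto simp: word_sum_def words_0 stats_def nstarts_def nlabel_def)
  also have "\<dots> = closed_word 0 \<kappa> \<mu>"
  proof (cases "\<forall>v<s. \<mu> v = 0")
    case True
    then have "(\<Prod>v<s. block_coeff e (\<mu> v) (\<kappa> v)) = (\<Prod>v<s. zdelta (\<kappa> v))"
      by (simp add: block_coeff_0_left)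
    then show ?thesis using True
      by (cases "\<forall>v<s. \<kappa> v = 0")
        (auto simp: closed_word_def multinom_def zfact_def zinvfact_def zdelta_def)
  next
    case False
    then show ?thesis using prod_block_coeff_sum_le_0[of \<mu> \<kappa>] by (auto simp: closed_word_def)
  qed
  finally show ?thesis .
qed

text \<open>Word sums, sums over starting letters and sums by first label satisfy the same
  recurrences as their closed forms. Proving all three together lets the induction advance by one
  length at a time.\<close>

theorem word_sum_closed_form:
  "word_sum L \<kappa> \<mu> = closed_word (int L) \<kappa> \<mu>"
proof -
  have "(\<forall>\<kappa> \<mu>. word_sum L \<kappa> \<mu> = closed_word (int L) \<kappa> \<mu>) \<and>
     (\<forall>v<s. \<forall>\<kappa> \<mu>. head_sum v 0 L \<kappa> \<mu> = closed_word (int L - 1) (dec v \<kappa>) (dec v \<mu>) \<and>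
        label_sum v L \<kappa> \<mu> = closed_label v (int L) \<kappa> \<mu>)"
  proof (induction L)
    case 0
    show ?case
      by (simp add: word_sum_0 head_sum_0 label_sum_def closed_word_neg closed_label_0)
  next
    case (Suc L)
    have h: "head_sum v 0 (Suc L) \<kappa> \<mu> = closed_word (int L) (dec v \<kappa>) (dec v \<mu>)" if "v < s" for v \<kappa> \<mu>
      using Suc that by (simp add: head_sum_start)
    have l: "label_sum v (Suc L) \<kappa> \<mu> = closed_label v (int L + 1) \<kappa> \<mu>" if v: "v < s" for v \<kappa> \<mu>
    proof -
      have "label_sum v (Suc L) \<kappa> \<mu> + closed_label v (int L) \<kappa> (dec v \<mu>) =
          label_sum v (Suc L) \<kappa> \<mu> + label_sum v L \<kappa> (dec v \<mu>)"
        using Suc v by simp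
      also have "\<dots> = head_sum v 0 (Suc L) \<kappa> \<mu> - of_nat e * head_sum v 0 L \<kappa> (dec v \<mu>)"
        using v by (rule label_sum_rec)
      also have "\<dots> = closed_word (int L) (dec v \<kappa>) (dec v \<mu>) -
          of_nat e * closed_word (int L - 1) (dec v \<kappa>) (dec v (dec v \<mu>))"
        using Suc v by (simp only: h)
      also have "\<dots> = closed_label v (int L + 1) \<kappa> \<mu> + closed_label v (int L) \<kappa> (dec v \<mu>)"
        using v by (simp only: closed_label_rec)
      finally show ?thesis by simp
    qed
    have "word_sum (Suc L) \<kappa> \<mu> = closed_word (int L + 1) \<kappa> \<mu>" for \<kappa> \<mu>
      by (simp add: word_sum_Suc l closed_word_eq_sum_label)
    then show ?case using h l by (simp add: add.commute)
  qed
  then show ?thesis by blast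
qed

end

section \<open>Splitting positions into paths\<close>

lemma length_filter_rev_map:
  "length (filter P (rev (map g [0..<L]))) = (\<Sum>h<L. of_bool (P (g h)))"
  by (induction L) auto

text \<open>Reversal places the latest position at the head, so appending a position to the path
  prepends a letter to the word.\<close>

lemma word_wt_path:
  assumes "u < r"
  shows "word_wt (rev (map (\<lambda>h. x (1 + u + r * h)) [0..<L])) = (\<Prod>h<L. lwt r x (1 + u + r * h))"
proof (induction L)
  case (Suc L)
  let ?g = "\<lambda>h. x (1 + u + r * h)"
  let ?w = "rev (map ?g [0..<L])"
  obtain v m where vm: "?g L = (v, m)" by (cases "?g L") auto
  have "word_wt (rev (map ?g [0..<Suc L])) = word_wt ((v, m) # ?w)"
    using vm by simp
  also have "\<dots> = lwt r x (1 + u + r * L) * word_wt ?w"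
  proof (cases L)
    case 0
    then show ?thesis using assms vm by (simp add: lwt_def)
  next
    case (Suc L')
    then have "1 + u + r * L - r = 1 + u + r * L'" "r < 1 + u + r * L" by auto
    moreover have "hd ?w = ?g L'" "?w \<noteq> []" using Suc by simp_all
    ultimately show ?thesis using vm by (auto simp: lwt_def)
  qed
  finally show ?case by (simp only: Suc.IH prod.lessThan_Suc mult.commute[of "lwt r x (1 + u + r * L)"])
qed simp

definition path_words :: "nat \<Rightarrow> nat \<Rightarrow> (nat \<Rightarrow> nat \<times> nat) \<Rightarrow> nat \<Rightarrow> (nat \<times> nat) list" where
  "path_words r n x = (\<lambda>u\<in>{..<r}. rev (map (\<lambda>h. x (1 + u + r * h)) [0..<class_size r n u]))"

text \<open>Division of \<open>i - 1\<close> by \<open>r\<close> gives the path of position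
  \<open>i\<close> as remainder and its index on that path as quotient; \<open>un\<close> reads the
  letter off there.\<close>

lemma bij_betw_path_words:
  assumes r: "r \<ge> 1"
  shows "bij_betw (path_words r n) ({1..n} \<rightarrow>\<^sub>E letters s e)
    (PiE {..<r} (\<lambda>u. words s e (class_size r n u)))"
proof -
  define un where "un ws = (\<lambda>i\<in>{1..n}. rev (ws ((i - 1) mod r)) ! ((i - 1) div r))"
    for ws :: "nat \<Rightarrow> (nat \<times> nat) list"
  have idx: "(i - 1) mod r < r" "(i - 1) div r < class_size r n ((i - 1) mod r)"
    "1 + (i - 1) mod r + r * ((i - 1) div r) = i" if "i \<in> {1..n}" for i
    using r that by (simp_all add: less_class_size_iff)
  have bd: "1 + u + r * h \<in> {1..n}" if "u < r" "h < class_size r n u" for u h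
    using that by (simp add: less_class_size_iff)
  show ?thesis
  proof (rule bij_betw_byWitness[where f' = un])
    show "\<forall>x\<in>{1..n} \<rightarrow>\<^sub>E letters s e. un (path_words r n x) = x"
    proof
      fix x assume x: "x \<in> {1..n} \<rightarrow>\<^sub>E letters s e"
      show "un (path_words r n x) = x"
      proof
        fix i
        show "un (path_words r n x) i = x i"
        proof (cases "i \<in> {1..n}")
          case True
          then have "un (path_words r n x) i = x (1 + (i - 1) mod r + r * ((i - 1) div r))"
            using idx[OF True] by (simp add: un_def path_words_def)
          then show ?thesis by (simp only: idx(3)[OF True])
        next
          case False
          with x have "x i = undefined" by (rule PiE_arb)
          with False show ?thesis by (auto simp: un_def)
        qed
      qed
    qed
    show "\<forall>ws\<in>PiE {..<r} (\<lambda>u. words s e (class_size r n u)). path_words r n (un ws) = ws"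
    proof
      fix ws assume ws: "ws \<in> PiE {..<r} (\<lambda>u. words s e (class_size r n u))"
      show "path_words r n (un ws) = ws"
      proof
        fix u
        show "path_words r n (un ws) u = ws u"
        proof (cases "u < r")
          case True
          then have len: "length (ws u) = class_size r n u" using ws by (auto simp: words_def)
          have "map (\<lambda>h. un ws (1 + u + r * h)) [0..<class_size r n u] = rev (ws u)"
          proof (rule nth_equalityI)
            fix h assume "h < length (map (\<lambda>h. un ws (1 + u + r * h)) [0..<class_size r n u])"
            then have h: "h < class_size r n u" by simp
            have "un ws (1 + u + r * h) = rev (ws u) ! h"
              unfolding un_def using bd[OF True h] True by simp
            then show "map (\<lambda>h. un ws (1 + u + r * h)) [0..<class_size r n u] ! h = rev (ws u) ! h"
              using h by simp
          qed (simp add: len)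
          then show ?thesis using True by (simp add: path_words_def)
        next
          case False
          then show ?thesis using ws by (auto simp: path_words_def PiE_iff extensional_def)
        qed
      qed
    qed
    show "path_words r n ` ({1..n} \<rightarrow>\<^sub>E letters s e) \<subseteq> PiE {..<r} (\<lambda>u. words s e (class_size r n u))"
    proof (intro image_subsetI PiE_I)
      fix x u assume x: "x \<in> {1..n} \<rightarrow>\<^sub>E letters s e" and u: "u \<in> {..<r}"
      have "x (1 + u + r * h) \<in> letters s e" if "h < class_size r n u" for h
        using bd[of u h] u that x by (intro PiE_mem[OF x]) auto
      then have "set (path_words r n x u) \<subseteq> letters s e"
        using u unfolding path_words_def by (simp add: image_subset_iff)
      then show "path_words r n x u \<in> words s e (class_size r n u)"
        using u by (simp add: path_words_def words_def)
    qed (auto simp: path_words_def)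
    show "un ` PiE {..<r} (\<lambda>u. words s e (class_size r n u)) \<subseteq> {1..n} \<rightarrow>\<^sub>E letters s e"
    proof (intro image_subsetI PiE_I)
      fix ws i assume ws: "ws \<in> PiE {..<r} (\<lambda>u. words s e (class_size r n u))" and i: "i \<in> {1..n}"
      let ?w = "ws ((i - 1) mod r)"
      have w: "?w \<in> words s e (class_size r n ((i - 1) mod r))"
        using ws idx(1)[OF i] by auto
      then have "rev ?w ! ((i - 1) div r) \<in> set (rev ?w)"
        using idx(2)[OF i] by (intro nth_mem) (simp add: words_def)
      then have "rev ?w ! ((i - 1) div r) \<in> set ?w" by simp
      moreover have "set ?w \<subseteq> letters s e" using w by (simp add: words_def)
      ultimately have "rev ?w ! ((i - 1) div r) \<in> letters s e" by blast
      then show "un ws i \<in> letters s e" using i by (simp only: un_def restrict_apply if_True)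
    qed (auto simp: un_def)
  qed
qed

lemma card_eq_sum_classes:
  assumes "r \<ge> 1"
  shows "card {i\<in>{1..n}. P (x i)} =
    (\<Sum>u<r. length (filter P (path_words r n x u)))"
proof -
  have "card {i\<in>{1..n}. P (x i)} = (\<Sum>i\<in>{1..n}. of_bool (P (x i)))"
    by (simp add: of_bool_def sum.If_cases Int_def)
  also have "\<dots> = (\<Sum>(u, h)\<in>(SIGMA u:{..<r}. {..<class_size r n u}). of_bool (P (x (1 + u + r * h))))"
    using sum.reindex_bij_betw[OF bij_betw_classes[OF assms, of n], of "\<lambda>i. of_bool (P (x i))", symmetric]
    by (simp only: case_prod_unfold)
  also have "\<dots> = (\<Sum>u<r. \<Sum>h<class_size r n u. of_bool (P (x (1 + u + r * h))))"
    by (rule sum.Sigma[symmetric]) auto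
  also have "\<dots> = (\<Sum>u<r. length (filter P (path_words r n x u)))"
    by (intro sum.cong refl) (simp add: path_words_def length_filter_rev_map)
  finally show ?thesis .
qed

text \<open>The local weight compares only positions at distance \<open>r\<close>, so it factorises
  over the paths. The paths interact only through the totals for each value class.\<close>

lemma card_good_eq_sum_words:
  assumes "r \<ge> 1" "s \<ge> 1" "e \<le> 1"
  shows "of_nat (card {p. p permutes {1..n} \<and> good e r s n p}) =
    (\<Sum>ws\<in>PiE {..<r} (\<lambda>u. words s e (class_size r n u)). (\<Prod>u<r. word_wt (ws u)) *
      (\<Prod>v<s. if (\<Sum>u<r. nlabel (ws u) v) = class_size s n v
        then fact (\<Sum>u<r. nstarts (ws u) v) else 0))"
proof -
  have 1: "(\<Prod>i\<in>{1..n}. lwt r x i) = (\<Prod>u<r. word_wt (path_words r n x u))" for x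
    unfolding prod_classes[OF assms(1)]
    by (intro prod.cong refl) (simp only: path_words_def restrict_apply if_True word_wt_path lessThan_iff)
  have 2: "card {i\<in>{1..n}. fst (x i) = v} = (\<Sum>u<r. nlabel (path_words r n x u) v)"
    "card {i\<in>{1..n}. x i = (v, 0)} = (\<Sum>u<r. nstarts (path_words r n x u) v)" for x :: "nat \<Rightarrow> nat \<times> nat" and v
    unfolding nlabel_def nstarts_def
    using card_eq_sum_classes[OF assms(1), of n "\<lambda>l. fst l = v" x]
      card_eq_sum_classes[OF assms(1), of n "\<lambda>l. l = (v, 0)" x] by simp_all
  show ?thesis
    unfolding card_good_eq_sum_letters[OF assms] 1 2
    by (subst sum.reindex_bij_betw[OF bij_betw_path_words[OF assms(1)], symmetric]) (rule refl)
qed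

section \<open>Tame building blocks\<close>

definition affine_form :: "'i set \<Rightarrow> (('i \<Rightarrow> int) \<Rightarrow> int) \<Rightarrow> bool" where
  "affine_form I l \<longleftrightarrow> (\<exists>a b. \<forall>z. l z = (\<Sum>i\<in>I. a i * z i) + b)"

lemma affine_const: "affine_form I (\<lambda>_. c)"
  unfolding affine_form_def by (intro exI[of _ "\<lambda>_. 0"] exI[of _ c]) simp

lemma affine_var: "finite I \<Longrightarrow> i \<in> I \<Longrightarrow> affine_form I (\<lambda>z. z i)"
  unfolding affine_form_def
  by (intro exI[of _ "\<lambda>j. if j = i then 1 else 0"] exI[of _ 0]) (simp add: if_distrib[of "\<lambda>x. x * _"] cong: if_cong)

lemma affine_add:
  assumes "affine_form I l" "affine_form I m"
  shows "affine_form I (\<lambda>z. l z + m z)"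
proof -
  from assms obtain a b a' b' where "\<And>z. l z = (\<Sum>i\<in>I. a i * z i) + b" "\<And>z. m z = (\<Sum>i\<in>I. a' i * z i) + b'"
    unfolding affine_form_def by metis
  then show ?thesis unfolding affine_form_def
    by (intro exI[of _ "\<lambda>i. a i + a' i"] exI[of _ "b + b'"]) (simp add: distrib_right sum.distrib)
qed

lemma affine_cmult:
  assumes "affine_form I l"
  shows "affine_form I (\<lambda>z. c * l z)"
proof -
  from assms obtain a b where "\<And>z. l z = (\<Sum>i\<in>I. a i * z i) + b"
    unfolding affine_form_def by metis
  then show ?thesis unfolding affine_form_def
    by (intro exI[of _ "\<lambda>i. c * a i"] exI[of _ "c * b"]) (simp add: distrib_left sum_distrib_left mult.assoc)
qed

lemma affine_diff: "affine_form I l \<Longrightarrow> affine_form I m \<Longrightarrow> affine_form I (\<lambda>z. l z - m z)"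
  using affine_add[of I l "\<lambda>z. -1 * m z"] affine_cmult[of I m "-1"] by simp

lemma affine_sum: "(\<And>x. x \<in> X \<Longrightarrow> affine_form I (l x)) \<Longrightarrow> affine_form I (\<lambda>z. \<Sum>x\<in>X. l x z)"
  by (induction X rule: infinite_finite_induct) (auto intro: affine_const affine_add)

lemma tame_compose_affine:
  assumes "tame1 f" "finite I" "affine_form I l"
  shows "tame I (\<lambda>z. f (l z))"
proof -
  from assms(3) obtain a b where "l = (\<lambda>z. (\<Sum>i\<in>I. a i * z i) + b)"
    unfolding affine_form_def by blast
  with tame_affine[OF assms(1,2)] show ?thesis by simp
qed

text \<open>Coefficient of \<open>t ^ j\<close> in \<open>(1 - e * t) ^ k\<close>, written with
  factorials so that tameness is visible.\<close>

definition lower_coeff :: "nat \<Rightarrow> int \<Rightarrow> int \<Rightarrow> rat" where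
  "lower_coeff e k j = zfact k * zinvfact j * zinvfact (k - j) * zpow (- of_nat e) j"

text \<open>Coefficient of \<open>t ^ m\<close> in \<open>(1 + t) ^ (- k)\<close>. At
  \<open>k = 0\<close> the factorial formula gives zero, and the deltas supply the constant series
  1.\<close>

definition upper_coeff :: "int \<Rightarrow> int \<Rightarrow> rat" where
  "upper_coeff k m = zfact (k + m - 1) * zinvfact (k - 1) * zinvfact m * zpow (- 1) m + zdelta k * zdelta m"

text \<open>Of the total degree \<open>l\<close>, the factor \<open>t ^ k\<close> takes
  \<open>k\<close>, the numerator takes \<open>j\<close> and the denominator takes the rest.\<close>

definition block_term :: "nat \<Rightarrow> int \<Rightarrow> int \<Rightarrow> int \<Rightarrow> rat" where
  "block_term e l k j = lower_coeff e k j * upper_coeff k (l - k - j)"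

section \<open>Expansion of the block coefficients into factorials and powers\<close>

lemma fps_nth_lower_power:
  "fps_nth ((1 - of_nat e * fps_X) ^ k) j = lower_coeff e (int k) (int j)"
proof -
  have "fps_nth ((1 - fps_const a * fps_X) ^ k) j = of_nat (k choose j) * (- a) ^ j" for a :: rat
  proof (induction k arbitrary: j)
    case 0
    show ?case by (cases j) auto
  next
    case (Suc k)
    let ?F = "1 - fps_const a * fps_X"
    have eq: "?F ^ Suc k = ?F ^ k - fps_const a * (fps_X * ?F ^ k)"
      by (simp add: algebra_simps)
    have "fps_nth (?F ^ Suc k) j = of_nat (k choose j) * (- a) ^ j -
        a * (if j = 0 then 0 else of_nat (k choose (j - 1)) * (- a) ^ (j - 1))"
      unfolding eq by (simp add: Suc.IH)
    also have "\<dots> = of_nat (Suc k choose j) * (- a) ^ j"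
      by (cases j) (simp_all add: algebra_simps)
    finally show ?case .
  qed
  from this[of "of_nat e"]
  have "fps_nth ((1 - of_nat e * fps_X) ^ k) j = of_nat (k choose j) * (- of_nat e :: rat) ^ j"
    by (simp add: fps_of_nat)
  also have "\<dots> = lower_coeff e (int k) (int j)"
  proof (cases "j \<le> k")
    case True
    then show ?thesis
      by (simp add: lower_coeff_def zfact_def zinvfact_def zpow_def binomial_fact field_simps nat_diff_distrib')
  next
    case False
    then show ?thesis by (simp add: lower_coeff_def zinvfact_def binomial_eq_0)
  qed
  finally show ?thesis .
qed

text \<open>The binomial series with exponent \<open>- k\<close>, followed by negation of the upper
  index.\<close>

lemma fps_nth_upper_power:
  "fps_nth (inverse (1 + fps_X) ^ k) m = upper_coeff (int k) (int m)"
proof (cases k)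
  case 0
  then show ?thesis by (simp add: upper_coeff_def zinvfact_def zdelta_def)
next
  case (Suc k')
  have "inverse (1 + fps_X) ^ k = fps_binomial (- of_nat k :: rat)" for k
  proof (induction k)
    case (Suc k)
    have "inverse (1 + fps_X) ^ Suc k = fps_binomial (- 1) * fps_binomial (- of_nat k :: rat)"
      by (simp add: Suc.IH fps_binomial_minus_one)
    also have "\<dots> = fps_binomial (- 1 + - of_nat k)" by (rule fps_binomial_add_mult[symmetric])
    finally show ?case by simp
  qed simp
  then have "fps_nth (inverse (1 + fps_X) ^ k) m = ((- of_nat k :: rat) gchoose m)" by simp
  also have "\<dots> = (- 1) ^ m * (of_nat (k' + m) gchoose m)"
    using gbinomial_minus[of "of_nat k :: rat" m] Suc by simp
  also have "\<dots> = (- 1) ^ m * of_nat (k' + m choose m)"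
    by (simp only: binomial_gbinomial)
  also have "\<dots> = (- 1) ^ m * (fact (k' + m) / (fact m * fact k'))"
    by (simp add: binomial_fact)
  also have "\<dots> = upper_coeff (int k) (int m)"
    using Suc by (simp add: upper_coeff_def zfact_def zinvfact_def zdelta_def zpow_def nat_add_distrib field_simps)
  finally show ?thesis .
qed

lemma block_term_support:
  assumes "block_term e l k j \<noteq> 0"
  shows "0 \<le> j" "j \<le> k" "k + j \<le> l"
proof -
  show "0 \<le> j" "j \<le> k"
    using assms by (auto simp: block_term_def lower_coeff_def zinvfact_def split: if_splits)
  show "k + j \<le> l"
    using assms by (auto simp: block_term_def upper_coeff_def zinvfact_def zdelta_def split: if_splits)
qed

text \<open>Cauchy product of the two expansions. The terms beyond \<open>l - k\<close> vanish, so
  the range can be the interval \<open>{0..int n}\<close> used for all summation variables.\<close>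

lemma sum_block_term:
  assumes "l \<le> int n"
  shows "(\<Sum>j\<in>{0..int n}. block_term e l k j) = block_coeff e l k"
proof (cases "0 \<le> k \<and> k \<le> l")
  case True
  define k' where "k' = nat k"
  define d where "d = nat (l - k)"
  have k: "k = int k'" and l: "l = int (k' + d)" using True by (simp_all add: k'_def d_def)
  have "block_coeff e l k = fps_nth (fps_X ^ k' * ((1 - of_nat e * fps_X) ^ k' * inverse (1 + fps_X) ^ k')) (k' + d)"
    unfolding block_coeff_def k l by (simp add: block_fps_def power_mult_distrib mult.assoc nat_add_distrib)
  also have "\<dots> = fps_nth ((1 - of_nat e * fps_X) ^ k' * inverse (1 + fps_X) ^ k') d"
    by (simp add: fps_X_power_mult_nth)
  also have "\<dots> = (\<Sum>i=0..d. block_term e l k (int i))"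
    unfolding fps_mult_nth fps_nth_lower_power fps_nth_upper_power
    by (intro sum.cong refl) (simp add: block_term_def k l of_nat_diff)
  also have "\<dots> = (\<Sum>j\<in>int ` {0..d}. block_term e l k j)"
    by (simp add: sum.reindex)
  also have "\<dots> = (\<Sum>j\<in>{0..int n}. block_term e l k j)"
  proof (rule sum.mono_neutral_left)
    show "int ` {0..d} \<subseteq> {0..int n}" using assms l by auto
    show "\<forall>j\<in>{0..int n} - int ` {0..d}. block_term e l k j = 0"
    proof
      fix j assume j: "j \<in> {0..int n} - int ` {0..d}"
      then have "j = int (nat j)" by simp
      with j have "nat j \<notin> {0..d}" by (metis DiffD2 imageI)
      then have "j > l - k" using j k l by auto
      then show "block_term e l k j = 0" using block_term_support(3)[of e l k j] by linarith
    qed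
  qed simp
  finally show ?thesis by simp
next
  case False
  have "block_coeff e l k = 0"
  proof (cases "0 \<le> k \<and> 0 \<le> l")
    case True
    then have "block_coeff e l k = fps_nth (fps_X ^ nat k * ((1 - of_nat e * fps_X) ^ nat k * inverse (1 + fps_X) ^ nat k)) (nat l)"
      unfolding block_coeff_def by (simp add: block_fps_def power_mult_distrib mult.assoc)
    then show ?thesis using True False by (simp add: fps_X_power_mult_nth)
  qed (auto simp: block_coeff_def)
  moreover have "block_term e l k j = 0" for j
    using block_term_support[of e l k j] False by linarith
  ultimately show ?thesis by simp
qed

lemma tame_block_term:
  assumes "finite I" "affine_form I l" "affine_form I k" "affine_form I j"
  shows "tame I (\<lambda>z. block_term e (l z) (k z) (j z))"
  unfolding block_term_def lower_coeff_def upper_coeff_def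
  by (intro tame_add tame_mult tame_compose_affine[OF tame1_zfact] tame_compose_affine[OF tame1_zinvfact]
      tame_compose_affine[OF tame1_zpow] tame_compose_affine[OF tame1_zdelta]
      affine_add affine_diff affine_const assms)

text \<open>No floor occurs here, so that tameness follows from closure under affine substitution.\<close>

definition size_indicator :: "nat \<Rightarrow> nat \<Rightarrow> int \<Rightarrow> int \<Rightarrow> rat" where
  "size_indicator r u n y = (\<Sum>t<r. zdelta (n + int r - 1 - int u - int t - int r * y))"

text \<open>\<open>t\<close> runs through the possible remainders of \<open>n + r - 1 - u\<close>
  modulo \<open>r\<close>; one delta is nonzero exactly when \<open>y\<close> is the
  quotient.\<close>

lemma size_indicator_eq:
  assumes "u < r"
  shows "size_indicator r u (int n) y = of_bool (y = int (class_size r n u))"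
proof -
  define a where "a = int n + int r - 1 - int u"
  have "size_indicator r u (int n) y = (\<Sum>t<r. if int t = a - int r * y then 1 else 0)"
    unfolding size_indicator_def zdelta_def a_def by (intro sum.cong refl) auto
  also have "\<dots> = (\<Sum>t<r. if t = nat (a - int r * y) \<and> a - int r * y \<ge> 0 then 1 else 0)"
    by (intro sum.cong refl) auto
  also have "\<dots> = of_bool (0 \<le> a - int r * y \<and> a - int r * y < int r)"
    by (cases "a - int r * y \<ge> 0") auto
  also have "(0 \<le> a - int r * y \<and> a - int r * y < int r) \<longleftrightarrow> y = a div int r"
  proof
    assume "0 \<le> a - int r * y \<and> a - int r * y < int r"
    then show "y = a div int r"
      by (intro int_div_pos_eq[symmetric, of a "int r" y "a - int r * y"]) auto
  next
    assume "y = a div int r"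
    then have "a - int r * y = a mod int r" by (simp add: minus_mult_div_eq_mod)
    then show "0 \<le> a - int r * y \<and> a - int r * y < int r" using assms by simp
  qed
  also have "a div int r = int (class_size r n u)"
  proof -
    have "a = int (n + r - 1 - u)" using assms by (simp add: a_def of_nat_diff)
    then show ?thesis by (simp only: class_size_def zdiv_int)
  qed
  finally show ?thesis .
qed

lemma tame_size_indicator:
  assumes "finite I" "affine_form I n" "affine_form I y"
  shows "tame I (\<lambda>z. size_indicator r u (n z) (y z))"
  unfolding size_indicator_def
  by (intro tame_sum tame_compose_affine[OF tame1_zdelta] affine_add affine_diff affine_const affine_cmult assms)

lemma class_size_le:
  assumes "u < r"
  shows "class_size r n u \<le> n"
proof (rule ccontr)
  assume "\<not> ?thesis"
  then have "n < class_size r n u" by simp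
  then have "1 + u + r * n \<le> n" by (simp only: less_class_size_iff[OF assms])
  moreover have "n \<le> r * n" using assms by simp
  ultimately show False by linarith
qed

lemma sum_PiE_Un:
  assumes "A \<inter> B = {}"
  shows "(\<Sum>z\<in>A \<union> B \<rightarrow>\<^sub>E X. f z) =
    (\<Sum>a\<in>A \<rightarrow>\<^sub>E X. \<Sum>b\<in>B \<rightarrow>\<^sub>E X. f (\<lambda>i. if i \<in> A then a i else b i))"
proof -
  have "(\<Sum>z\<in>A \<union> B \<rightarrow>\<^sub>E X. f z) =
      (\<Sum>(a, b)\<in>(A \<rightarrow>\<^sub>E X) \<times> (B \<rightarrow>\<^sub>E X). f (\<lambda>i. if i \<in> A then a i else b i))"
  proof (rule sum.reindex_bij_witness[where i = "\<lambda>(a, b) i. if i \<in> A then a i else b i"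
        and j = "\<lambda>z. (restrict z A, restrict z B)"], goal_cases)
    case (1 z)
    then show ?case by (auto simp: fun_eq_iff PiE_iff extensional_def)
  next
    case (2 z)
    then show ?case by auto
  next
    case (3 p)
    then show ?case using assms by (auto simp: fun_eq_iff PiE_iff extensional_def)
  next
    case (4 p)
    then show ?case by (auto simp: PiE_iff extensional_def split: if_splits)
  next
    case (5 z)
    then have "(\<lambda>i. if i \<in> A then restrict z A i else restrict z B i) = z"
      by (auto simp: fun_eq_iff PiE_iff extensional_def)
    then show ?case by simp
  qed
  then show ?thesis by (simp add: sum.cartesian_product)
qed

section \<open>The summand\<close>

text \<open>Coordinates: \<open>n\<close> sits at \<open>(0, 0, 0)\<close>. For the positions congruent to \<open>u + 1\<close> modulo \<open>r\<close> whose
  values are congruent to \<open>v + 1\<close> modulo \<open>s\<close>, \<open>(1, u, v)\<close> counts blocks and \<open>(2, u, v)\<close>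
  counts positions; \<open>(3, u, v)\<close> is the extra summation variable of \<open>sum_block_term\<close>.\<close>

type_synonym coord = "nat \<times> nat \<times> nat"

abbreviation stat_coords :: "nat \<Rightarrow> nat \<Rightarrow> coord set" where
  "stat_coords r s \<equiv> {1, 2} \<times> {..<r} \<times> {..<s}"

abbreviation aux_coords :: "nat \<Rightarrow> nat \<Rightarrow> coord set" where
  "aux_coords r s \<equiv> {3} \<times> {..<r} \<times> {..<s}"

text \<open>One factor per position class: the block lengths fill the class, and the multinomial
  coefficient orders the labels along the path.\<close>

definition path_part :: "nat \<Rightarrow> nat \<Rightarrow> (coord \<Rightarrow> int) \<Rightarrow> rat" where
  "path_part r s z = (\<Prod>u<r. size_indicator r u (z (0, 0, 0)) (\<Sum>v<s. z (2, u, v)) * multinom s (\<lambda>v. z (1, u, v)))"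

text \<open>One factor per value class: the lengths fill the class, and its blocks may be placed in
  any order.\<close>

definition class_part :: "nat \<Rightarrow> nat \<Rightarrow> (coord \<Rightarrow> int) \<Rightarrow> rat" where
  "class_part r s z = (\<Prod>v<s. size_indicator s v (z (0, 0, 0)) (\<Sum>u<r. z (2, u, v)) * zfact (\<Sum>u<r. z (1, u, v)))"

definition block_part :: "nat \<Rightarrow> nat \<Rightarrow> nat \<Rightarrow> (coord \<Rightarrow> int) \<Rightarrow> rat" where
  "block_part e r s z = (\<Prod>u<r. \<Prod>v<s. block_term e (z (2, u, v)) (z (1, u, v)) (z (3, u, v)))"

definition summand :: "nat \<Rightarrow> nat \<Rightarrow> nat \<Rightarrow> (coord \<Rightarrow> int) \<Rightarrow> rat" where
  "summand e r s z = path_part r s z * class_part r s z * block_part e r s z"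

lemma tame_summand:
  assumes "finite I" "(0, 0, 0) \<in> I" "stat_coords r s \<subseteq> I" "aux_coords r s \<subseteq> I"
  shows "tame I (summand e r s)"
proof -
  have "affine_form I (\<lambda>z. z (0, 0, 0))" using assms by (intro affine_var)
  moreover have "affine_form I (\<lambda>z. z (t, u, v))" if "t \<in> {1, 2, 3}" "u \<in> {..<r}" "v \<in> {..<s}" for t u v
    using assms that by (intro affine_var) auto
  ultimately have "tame I (\<lambda>z. path_part r s z * class_part r s z * block_part e r s z)"
    unfolding path_part_def class_part_def block_part_def multinom_def using assms(1)
    by (intro tame_mult tame_prod tame_size_indicator tame_block_term affine_sum
        tame_compose_affine[OF tame1_zfact] tame_compose_affine[OF tame1_zinvfact]) auto
  then show ?thesis unfolding summand_def .
qed

text \<open>Nonzero block terms force all coordinates to be nonnegative and bounded by the length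
  coordinate. The lengths in one position class add up to at most \<open>n\<close>, which bounds
  everything.\<close>

lemma summand_support:
  assumes "z \<in> extensional (stat_coords r s \<union> aux_coords r s)"
    and "z \<notin> stat_coords r s \<union> aux_coords r s \<rightarrow>\<^sub>E {0..int n}"
  shows "summand e r s (z((0, 0, 0) := int n)) = 0"
proof (rule ccontr)
  assume nz: "summand e r s (z((0, 0, 0) := int n)) \<noteq> 0"
  then have block: "block_term e (z (2, u, v)) (z (1, u, v)) (z (3, u, v)) \<noteq> 0" if "u < r" "v < s" for u v
    using that by (auto simp: summand_def block_part_def)
  note supp = block_term_support[OF block]
  have "z i \<in> {0..int n}" if i: "i \<in> stat_coords r s \<union> aux_coords r s" for i
  proof -
    obtain t u v where tuv: "i = (t, u, v)" "t \<in> {1, 2, 3}" "u < r" "v < s" using i by auto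
    have "size_indicator r u (int n) (\<Sum>v<s. z (2, u, v)) \<noteq> 0"
      using nz tuv by (auto simp: summand_def path_part_def)
    then have "(\<Sum>v<s. z (2, u, v)) = int (class_size r n u)"
      using tuv by (simp add: size_indicator_eq)
    also have "\<dots> \<le> int n" using tuv by (simp add: class_size_le)
    finally have "(\<Sum>v<s. z (2, u, v)) \<le> int n" .
    moreover have "z (2, u, v) \<le> (\<Sum>v<s. z (2, u, v))"
      using tuv supp[of u] by (intro member_le_sum) force+
    ultimately have "z (2, u, v) \<le> int n" by simp
    with supp[OF tuv(3,4)] tuv show ?thesis by auto
  qed
  with assms show False by (auto simp: PiE_iff)
qed

text \<open>Each auxiliary variable occurs in a single block term, so the sum over all of them is a
  product of one-variable sums.\<close>

lemma sum_block_part: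
  assumes "a \<in> stat_coords r s \<rightarrow>\<^sub>E {0..int n}"
  shows "(\<Sum>b\<in>aux_coords r s \<rightarrow>\<^sub>E {0..int n}. block_part e r s (\<lambda>i. if i \<in> stat_coords r s then a i else b i)) =
    (\<Prod>u<r. \<Prod>v<s. block_coeff e (a (2, u, v)) (a (1, u, v)))"
proof -
  have flat: "(\<Prod>i\<in>aux_coords r s. f i) = (\<Prod>u<r. \<Prod>v<s. f (3, u, v))" for f :: "coord \<Rightarrow> rat"
    by (simp add: prod.cartesian_product[symmetric] prod.cartesian_product')
  let ?t = "\<lambda>i j. block_term e (a (2, snd i)) (a (1, snd i)) j"
  have "(\<Sum>b\<in>aux_coords r s \<rightarrow>\<^sub>E {0..int n}. block_part e r s (\<lambda>i. if i \<in> stat_coords r s then a i else b i)) =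
      (\<Sum>b\<in>aux_coords r s \<rightarrow>\<^sub>E {0..int n}. \<Prod>i\<in>aux_coords r s. ?t i (b i))"
    unfolding flat block_part_def by (intro sum.cong prod.cong refl) auto
  also have "\<dots> = (\<Prod>i\<in>aux_coords r s. \<Sum>j\<in>{0..int n}. ?t i j)"
    by (rule prod_sum_PiE[symmetric]) auto
  also have "\<dots> = (\<Prod>i\<in>aux_coords r s. block_coeff e (a (2, snd i)) (a (1, snd i)))"
  proof (intro prod.cong refl sum_block_term)
    fix i assume "i \<in> aux_coords r s"
    then have "(2, snd i) \<in> stat_coords r s" by auto
    from PiE_mem[OF assms this] show "a (2, snd i) \<le> int n" by simp
  qed
  also have "\<dots> = (\<Prod>u<r. \<Prod>v<s. block_coeff e (a (2, u, v)) (a (1, u, v)))"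
    unfolding flat by simp
  finally show ?thesis .
qed

text \<open>Words are grouped by their statistics, each path is replaced by the closed form, and the
  block coefficients are expanded with the auxiliary variables.\<close>

lemma card_good_eq_sum_summand:
  assumes rs: "r \<ge> 1" "s \<ge> 1" and e: "e \<le> 1"
  shows "of_nat (card {p. p permutes {1..n} \<and> good e r s n p}) =
    (\<Sum>z\<in>stat_coords r s \<union> aux_coords r s \<rightarrow>\<^sub>E {0..int n}. summand e r s (z((0, 0, 0) := int n)))"
proof -
  let ?A = "stat_coords r s \<rightarrow>\<^sub>E {0..int n}"
  let ?W = "PiE {..<r} (\<lambda>u. words s e (class_size r n u))"
  let ?st = "\<lambda>a u. stats s (\<lambda>v. a (1, u, v)) (\<lambda>v. a (2, u, v))"
  have finA: "finite ?A" by (intro finite_PiE) auto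
  define st where "st ws = (\<lambda>(t, u, v)\<in>stat_coords r s.
      int (if t = 1 then nstarts (ws u) v else nlabel (ws u) v))" for ws :: "nat \<Rightarrow> (nat \<times> nat) list"
  define G where "G a = class_part r s (a((0, 0, 0) := int n))" for a
  have st_A: "st ws \<in> ?A" if "ws \<in> ?W" for ws
  proof (rule PiE_I)
    fix i assume "i \<in> stat_coords r s"
    then obtain t u v where i: "i = (t, u, v)" "t \<in> {1, 2}" "u < r" "v < s" by auto
    then have "length (ws u) = class_size r n u" using that by (auto simp: words_def)
    then have "nstarts (ws u) v \<le> n" "nlabel (ws u) v \<le> n"
      using class_size_le[OF i(3), of n]
      by (auto simp: nstarts_def nlabel_def intro: order.trans[OF length_filter_le])
    then show "st ws i \<in> {0..int n}" using i by (auto simp: st_def)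
  qed (auto simp: st_def)
  have st_eq: "(\<forall>u<r. ?st a u (ws u)) \<longleftrightarrow> a = st ws" if "a \<in> ?A" for a ws
  proof
    assume *: "\<forall>u<r. ?st a u (ws u)"
    show "a = st ws"
    proof
      fix i
      show "a i = st ws i"
      proof (cases "i \<in> stat_coords r s")
        case True
        then show ?thesis using * by (auto simp: st_def stats_def)
      next
        case False
        with that have "a i = undefined" by (rule PiE_arb)
        with False show ?thesis by (auto simp: st_def)
      qed
    qed
  next
    assume "a = st ws"
    then show "\<forall>u<r. ?st a u (ws u)" by (auto simp: st_def stats_def)
  qed
  have G_st: "G (st ws) = (\<Prod>v<s. if (\<Sum>u<r. nlabel (ws u) v) = class_size s n v
        then fact (\<Sum>u<r. nstarts (ws u) v) else 0)" for ws
    unfolding G_def class_part_def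
  proof (intro prod.cong refl)
    fix v assume "v \<in> {..<s}"
    then have v: "v < s" by simp
    have "(\<Sum>u<r. ((st ws)((0, 0, 0) := int n)) (2, u, v)) = int (\<Sum>u<r. nlabel (ws u) v)"
      "(\<Sum>u<r. ((st ws)((0, 0, 0) := int n)) (1, u, v)) = int (\<Sum>u<r. nstarts (ws u) v)"
      using v by (auto simp: st_def intro!: sum.cong)
    then show "size_indicator s v (((st ws)((0, 0, 0) := int n)) (0, 0, 0))
        (\<Sum>u<r. ((st ws)((0, 0, 0) := int n)) (2, u, v)) *
        zfact (\<Sum>u<r. ((st ws)((0, 0, 0) := int n)) (1, u, v)) =
      (if (\<Sum>u<r. nlabel (ws u) v) = class_size s n v then fact (\<Sum>u<r. nstarts (ws u) v) else 0)"
      by (simp only: fun_upd_same size_indicator_eq[OF v] of_nat_eq_iff) (simp add: zfact_def del: of_nat_sum)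
  qed
  have "of_nat (card {p. p permutes {1..n} \<and> good e r s n p}) =
      (\<Sum>ws\<in>?W. (\<Prod>u<r. word_wt (ws u)) * G (st ws))"
    unfolding G_st using assms by (rule card_good_eq_sum_words)
  \<comment> \<open>For each tuple of words exactly one table of statistics satisfies the indicator,
    namely \<open>st ws\<close>. Summing over all tables allows the two sums to be
    exchanged.\<close>
  also have "\<dots> = (\<Sum>ws\<in>?W. \<Sum>a\<in>?A. of_bool (\<forall>u<r. ?st a u (ws u)) * ((\<Prod>u<r. word_wt (ws u)) * G a))"
  proof (intro sum.cong refl)
    fix ws assume ws: "ws \<in> ?W"
    have "(\<Sum>a\<in>?A. of_bool (\<forall>u<r. ?st a u (ws u)) * ((\<Prod>u<r. word_wt (ws u)) * G a)) =
        (\<Sum>a\<in>?A. if a = st ws then (\<Prod>u<r. word_wt (ws u)) * G a else 0)"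
      by (intro sum.cong refl) (simp only: st_eq of_bool_def mult_1 mult_zero_left if_distrib[of "\<lambda>x. x * _"])
    also have "\<dots> = (\<Prod>u<r. word_wt (ws u)) * G (st ws)"
      using finA st_A[OF ws] by simp
    finally show "(\<Prod>u<r. word_wt (ws u)) * G (st ws) =
        (\<Sum>a\<in>?A. of_bool (\<forall>u<r. ?st a u (ws u)) * ((\<Prod>u<r. word_wt (ws u)) * G a))" ..
  qed
  also have "\<dots> = (\<Sum>a\<in>?A. \<Sum>ws\<in>?W. of_bool (\<forall>u<r. ?st a u (ws u)) * ((\<Prod>u<r. word_wt (ws u)) * G a))"
    by (rule sum.swap)
  also have "\<dots> = (\<Sum>a\<in>?A. (\<Prod>u<r. word_sum s e (class_size r n u) (\<lambda>v. a (1, u, v)) (\<lambda>v. a (2, u, v))) * G a)"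
  proof (intro sum.cong refl)
    fix a :: "coord \<Rightarrow> int"
    have "of_bool (\<forall>u<r. ?st a u (ws u)) = (\<Prod>u<r. of_bool (?st a u (ws u)) :: rat)" for ws
      by (cases "\<forall>u<r. ?st a u (ws u)") auto
    then have "(\<Sum>ws\<in>?W. of_bool (\<forall>u<r. ?st a u (ws u)) * ((\<Prod>u<r. word_wt (ws u)) * G a)) =
        (\<Sum>ws\<in>?W. \<Prod>u<r. of_bool (?st a u (ws u)) * word_wt (ws u)) * G a"
      by (simp only: prod.distrib sum_distrib_right mult.assoc)
    also have "(\<Sum>ws\<in>?W. \<Prod>u<r. of_bool (?st a u (ws u)) * word_wt (ws u)) =
        (\<Prod>u<r. word_sum s e (class_size r n u) (\<lambda>v. a (1, u, v)) (\<lambda>v. a (2, u, v)))"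
      unfolding word_sum_def by (rule prod_sum_PiE[symmetric]) auto
    finally show "(\<Sum>ws\<in>?W. of_bool (\<forall>u<r. ?st a u (ws u)) * ((\<Prod>u<r. word_wt (ws u)) * G a)) =
        (\<Prod>u<r. word_sum s e (class_size r n u) (\<lambda>v. a (1, u, v)) (\<lambda>v. a (2, u, v))) * G a" .
  qed
  also have "\<dots> = (\<Sum>a\<in>?A. path_part r s (a((0, 0, 0) := int n)) * G a *
      (\<Prod>u<r. \<Prod>v<s. block_coeff e (a (2, u, v)) (a (1, u, v))))"
  proof (intro sum.cong refl)
    fix a :: "coord \<Rightarrow> int"
    \<comment> \<open>The length condition inside \<open>closed_word\<close> is what
      \<open>size_indicator\<close> expresses on path \<open>u\<close>.\<close>
    have "(\<Prod>u<r. word_sum s e (class_size r n u) (\<lambda>v. a (1, u, v)) (\<lambda>v. a (2, u, v))) =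
      path_part r s (a((0, 0, 0) := int n)) * (\<Prod>u<r. \<Prod>v<s. block_coeff e (a (2, u, v)) (a (1, u, v)))"
      unfolding path_part_def prod.distrib[symmetric]
      by (intro prod.cong refl) (auto simp: word_sum_closed_form closed_word_def size_indicator_eq)
    then show "(\<Prod>u<r. word_sum s e (class_size r n u) (\<lambda>v. a (1, u, v)) (\<lambda>v. a (2, u, v))) * G a =
      path_part r s (a((0, 0, 0) := int n)) * G a * (\<Prod>u<r. \<Prod>v<s. block_coeff e (a (2, u, v)) (a (1, u, v)))"
      by simp
  qed
  also have "\<dots> = (\<Sum>a\<in>?A. \<Sum>b\<in>aux_coords r s \<rightarrow>\<^sub>E {0..int n}.
      summand e r s ((\<lambda>i. if i \<in> stat_coords r s then a i else b i)((0, 0, 0) := int n)))"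
  proof (intro sum.cong refl)
    fix a assume a: "a \<in> ?A"
    let ?z = "\<lambda>b i. if i \<in> stat_coords r s then a i else b i"
    have 1: "path_part r s ((?z b)((0, 0, 0) := int n)) = path_part r s (a((0, 0, 0) := int n))" for b
      unfolding path_part_def multinom_def by (intro prod.cong refl arg_cong2[where f = "(*)"]) (auto intro!: arg_cong[where f = "size_indicator r _ _"] arg_cong[where f = zfact] sum.cong prod.cong)
    have 2: "class_part r s ((?z b)((0, 0, 0) := int n)) = G a" for b
      unfolding class_part_def G_def by (intro prod.cong refl arg_cong2[where f = "(*)"]) (auto intro!: arg_cong[where f = "size_indicator s _ _"] arg_cong[where f = zfact] sum.cong)
    have 3: "block_part e r s ((?z b)((0, 0, 0) := int n)) = block_part e r s (?z b)" for b
      unfolding block_part_def by (intro prod.cong refl) auto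
    show "path_part r s (a((0, 0, 0) := int n)) * G a * (\<Prod>u<r. \<Prod>v<s. block_coeff e (a (2, u, v)) (a (1, u, v))) =
        (\<Sum>b\<in>aux_coords r s \<rightarrow>\<^sub>E {0..int n}. summand e r s ((?z b)((0, 0, 0) := int n)))"
      unfolding summand_def 1 2 3 sum_distrib_left[symmetric] sum_block_part[OF a] ..
  qed
  also have "\<dots> = (\<Sum>z\<in>stat_coords r s \<union> aux_coords r s \<rightarrow>\<^sub>E {0..int n}. summand e r s (z((0, 0, 0) := int n)))"
    by (rule sum_PiE_Un[symmetric]) auto
  finally show ?thesis .
qed

section \<open>Holonomicity of both counts\<close>

lemma holonomic_good:
  assumes "r \<ge> 1" "s \<ge> 1" "e \<le> 1"
  shows "holonomic (\<lambda>n. of_nat (card {p. p permutes {1..n} \<and> good e r s n p}) :: rat)"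
proof -
  let ?I' = "stat_coords r s \<union> aux_coords r s"
  let ?I = "insert (0, 0, 0) ?I'"
  have I': "?I - {(0, 0, 0)} = ?I'" by auto
  have "tame ?I (summand e r s)" by (rule tame_summand) auto
  then have "holonomic (\<lambda>n. \<Sum>z\<in>?I - {(0, 0, 0)} \<rightarrow>\<^sub>E {0..int n}. summand e r s (z((0, 0, 0) := int n)))"
  proof (rule holonomic_tame_sum, unfold I')
    fix n z
    assume "z \<in> extensional ?I'" "z \<notin> ?I' \<rightarrow>\<^sub>E {0..int n}"
    then show "summand e r s (z((0, 0, 0) := int n)) = 0" by (rule summand_support)
  qed auto
  then show ?thesis unfolding I' using assms by (simp only: card_good_eq_sum_summand)
qed

theorem theorem5p1:
  fixes r s :: nat
  assumes "r \<ge> 1" and "s \<ge> 1"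
  shows "holonomic (\<lambda>n. (of_nat (a_count r s n) :: rat)) \<and>
         holonomic (\<lambda>n. (of_nat (b_count r s n) :: rat))"
proof
  have "(int (p (i + r)) - int (p i) \<noteq> int s) \<longleftrightarrow> p (i + r) \<noteq> p i + s" for p i by linarith
  then have "a_count r s n = card {p. p permutes {1..n} \<and> good 0 r s n p}" for n
    unfolding a_count_def good_def by simp
  then show "holonomic (\<lambda>n. (of_nat (a_count r s n) :: rat))"
    using holonomic_good[OF assms, of 0] by simp
  have "(\<bar>int (p (i + r)) - int (p i)\<bar> \<noteq> int s) \<longleftrightarrow> p (i + r) \<noteq> p i + s \<and> p i \<noteq> p (i + r) + s" for p i
    by linarith
  then have "b_count r s n = card {p. p permutes {1..n} \<and> good 1 r s n p}" for n
    unfolding b_count_def good_def by simp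
  then show "holonomic (\<lambda>n. (of_nat (b_count r s n) :: rat))"
    using holonomic_good[OF assms, of 1] by simp
qed

end
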